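(* Let $d:\mathcal{A}\to A$ be any derivation. Then there exists $c_0\in\mathbb{C}$ such that $d(a)=c_0[\mathbb{K},a]+\tilde d(a)$ for all $a\in\mathcal{A}$, where $\tilde d:\mathcal{A}\to A$ is an approximately inner derivation.
   Context: Setup: $G$ is an infinite compact (Hausdorff) abelian group, written additively, and $x_1\in G$ generates a dense cyclic subgroup; put $x_n=nx_1$ and $\varphi(x)=x+x_1$. $\widehat G$ is the group of continuous characters of $G$. Let $H_+=\ell^2(\mathbb{Z}_{\ge 0})$ with canonical basis $\{E_k^+\}_{k\ge0}$; $UE_k^+=E_{k+1}^+$, $M^+_fE^+_k=f(x_k)E^+_k$ for $f\in C(G)$, and $\mathbb{K}E_k^+=kE_k^+$ (unbounded diagonal operator). $A=C^*(U,M^+_f:f\in C(G))$ and $\mathcal{A}$ is the $*$-subalgebra generated by $U,U^*,M^+_\chi$ ($\chi\in\widehat G$). Note $[\mathbb{K},a]\in\mathcal{A}$ for $a\in\mathcal{A}$ since $[\mathbb{K},U]=U$, $[\mathbb{K},U^*]=-U^*$, $[\mathbb{K},M^+_f]=0$. A derivation $d:\mathcal{A}\to A$ is a linear map with $d(ab)=ad(b)+d(a)b$. It is inner if $d(a)=[x,a]$ for some $x\in A$ and all $a\in\mathcal{A}$, and approximately inner if there are $x_j\in A$ with $d(a)=\lim_{j\to\infty}[x_j,a]$ in norm for every $a\in\mathcal{A}$. *)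

theory Defs
  imports "HOL-Analysis.Analysis"
begin

(* Bounded operators on H_+ = l^2(Z_{>=0}) are represented by their matrices
   T i j = <E_i, T E_j> w.r.t. the canonical basis {E_k}. *)
type_synonym mat = "nat \<Rightarrow> nat \<Rightarrow> complex"

definition opnorm_set :: "mat \<Rightarrow> real set" where
  "opnorm_set T = {cmod (\<Sum>i\<in>F. \<Sum>j\<in>F. cnj (w i) * T i j * v j) | F v w.
      finite F \<and> (\<Sum>j\<in>F. (cmod (v j))^2) \<le> 1 \<and> (\<Sum>i\<in>F. (cmod (w i))^2) \<le> 1}"

definition bounded_op :: "mat \<Rightarrow> bool" where
  "bounded_op T \<longleftrightarrow> bdd_above (opnorm_set T)"

definition opnorm :: "mat \<Rightarrow> real" where
  "opnorm T = Sup (opnorm_set T)"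

definition madd :: "mat \<Rightarrow> mat \<Rightarrow> mat" where
  "madd S T = (\<lambda>i j. S i j + T i j)"

definition msub :: "mat \<Rightarrow> mat \<Rightarrow> mat" where
  "msub S T = (\<lambda>i j. S i j - T i j)"

definition msmult :: "complex \<Rightarrow> mat \<Rightarrow> mat" where
  "msmult c T = (\<lambda>i j. c * T i j)"

definition mmult :: "mat \<Rightarrow> mat \<Rightarrow> mat" where
  "mmult S T = (\<lambda>i j. \<Sum>k. S i k * T k j)"

definition madj :: "mat \<Rightarrow> mat" where
  "madj T = (\<lambda>i j. cnj (T j i))"

definition mcomm :: "mat \<Rightarrow> mat \<Rightarrow> mat" where
  "mcomm S T = msub (mmult S T) (mmult T S)"

definition shiftU :: mat where
  "shiftU = (\<lambda>i j. if i = Suc j then 1 else 0)"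

(* [K, a] where K E_k = k E_k *)
definition Kcomm :: "mat \<Rightarrow> mat" where
  "Kcomm a = (\<lambda>i j. (of_nat i - of_nat j) * a i j)"

definition natmul :: "nat \<Rightarrow> 'g::ab_group_add \<Rightarrow> 'g" where
  "natmul n x = (((+) x) ^^ n) 0"

definition zmul :: "int \<Rightarrow> 'g::ab_group_add \<Rightarrow> 'g" where
  "zmul n x = (if 0 \<le> n then natmul (nat n) x else - natmul (nat (- n)) x)"

definition Mdiag :: "'g::ab_group_add \<Rightarrow> ('g \<Rightarrow> complex) \<Rightarrow> mat" where
  "Mdiag x1 f = (\<lambda>i j. if i = j then f (natmul i x1) else 0)"

definition character :: "('g::{topological_ab_group_add} \<Rightarrow> complex) \<Rightarrow> bool" where
  "character ch \<longleftrightarrow> continuous_on UNIV ch \<and> (\<forall>x y. ch (x + y) = ch x * ch y)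
     \<and> (\<forall>x. cmod (ch x) = 1)"

inductive_set calA :: "'g::topological_ab_group_add \<Rightarrow> mat set" for x1 :: 'g where
  gen_U: "shiftU \<in> calA x1"
| gen_Ustar: "madj shiftU \<in> calA x1"
| gen_chi: "character ch \<Longrightarrow> Mdiag x1 ch \<in> calA x1"
| add: "a \<in> calA x1 \<Longrightarrow> b \<in> calA x1 \<Longrightarrow> madd a b \<in> calA x1"
| smult: "a \<in> calA x1 \<Longrightarrow> msmult c a \<in> calA x1"
| mult: "a \<in> calA x1 \<Longrightarrow> b \<in> calA x1 \<Longrightarrow> mmult a b \<in> calA x1"
| adj: "a \<in> calA x1 \<Longrightarrow> madj a \<in> calA x1"

inductive_set starAlgC :: "'g::topological_ab_group_add \<Rightarrow> mat set" for x1 :: 'g where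
  gen_U: "shiftU \<in> starAlgC x1"
| gen_f: "continuous_on UNIV f \<Longrightarrow> Mdiag x1 f \<in> starAlgC x1"
| add: "a \<in> starAlgC x1 \<Longrightarrow> b \<in> starAlgC x1 \<Longrightarrow> madd a b \<in> starAlgC x1"
| smult: "a \<in> starAlgC x1 \<Longrightarrow> msmult c a \<in> starAlgC x1"
| mult: "a \<in> starAlgC x1 \<Longrightarrow> b \<in> starAlgC x1 \<Longrightarrow> mmult a b \<in> starAlgC x1"
| adj: "a \<in> starAlgC x1 \<Longrightarrow> madj a \<in> starAlgC x1"

definition algA :: "'g::topological_ab_group_add \<Rightarrow> mat set" where
  "algA x1 = {T. bounded_op T \<and>
     (\<forall>e>0. \<exists>S\<in>starAlgC x1. opnorm (msub T S) < e)}"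

definition is_derivation :: "'g::topological_ab_group_add \<Rightarrow> (mat \<Rightarrow> mat) \<Rightarrow> bool" where
  "is_derivation x1 d \<longleftrightarrow>
     (\<forall>a\<in>calA x1. d a \<in> algA x1) \<and>
     (\<forall>a\<in>calA x1. \<forall>b\<in>calA x1. d (madd a b) = madd (d a) (d b)) \<and>
     (\<forall>c. \<forall>a\<in>calA x1. d (msmult c a) = msmult c (d a)) \<and>
     (\<forall>a\<in>calA x1. \<forall>b\<in>calA x1. d (mmult a b) = madd (mmult a (d b)) (mmult (d a) b))"

definition approx_inner :: "'g::topological_ab_group_add \<Rightarrow> (mat \<Rightarrow> mat) \<Rightarrow> bool" where
  "approx_inner x1 d \<longleftrightarrow>
     (\<exists>x :: nat \<Rightarrow> mat. (\<forall>j. x j \<in> algA x1) \<and>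
        (\<forall>a\<in>calA x1. (\<lambda>j. opnorm (msub (d a) (mcomm (x j) a))) \<longlonglongrightarrow> 0))"

end

theory Submission
  imports Defs
begin

text \<open>
  Elements of \<open>calA\<close> are band matrices, so they can be multiplied with arbitrary matrices, and \<open>d\<close>
  is the commutator with a possibly unbounded matrix \<open>X\<close>.  For \<open>n \<noteq> 0\<close> the \<open>n\<close>-th diagonal of \<open>X\<close>
  lies in \<open>A\<close>: choosing a character with \<open>\<chi> (n x\<^sub>1) \<noteq> 1\<close>, it is recovered from the \<open>n\<close>-th diagonal of
  \<open>d M\<^sub>\<chi> = [X, M\<^sub>\<chi>]\<close> by dividing by \<open>1 - \<chi> (n x\<^sub>1)\<close>.  The increments \<open>\<alpha>\<close> of the main diagonal are a diagonal
  of \<open>d U\<close>; their ergodic means tend uniformly to a constant \<open>c\<^sub>0\<close>, and \<open>\<alpha>\<close> minus its \<open>N\<close>-th ergodic mean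
  is the coboundary of a diagonal operator of \<open>A\<close>.  These diagonal operators, together with the
  Fejer means of the off-diagonal part of \<open>X\<close>, are the required \<open>x\<^sub>j\<close>.

  That characters of a compact monothetic group separate points is proved without Haar measure:
  given \<open>y \<noteq> 0\<close>, take \<open>f\<close> with \<open>f 0 \<noteq> f y\<close>.  Returns of the orbit to a neighbourhood of \<open>0\<close> have
  bounded gaps, so finite Fourier analysis gives frequencies \<open>\<lambda>\<^sub>N\<close> for which the averages of
  \<open>(f (n x\<^sub>1 + y) - f (n x\<^sub>1)) \<lambda>\<^sub>N\<^sup>n\<close> over \<open>n < N\<close> stay away from \<open>0\<close>.  A cluster point of the twisted means
  of \<open>f\<close> is then a multiple of a character that is nontrivial at \<open>y\<close>.
\<close>

section \<open>Characters of compact monothetic groups\<close>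

lemma natmul_0 [simp]: "natmul 0 x = 0"
  by (simp add: natmul_def)

lemma natmul_Suc [simp]: "natmul (Suc n) x = x + natmul n x"
  by (simp add: natmul_def)

lemma natmul_add: "natmul (m + n) x = natmul m x + natmul n x"
  by (induction m) (auto simp: algebra_simps)

text \<open>Matrix indices see only the forward orbit; this is how a displacement by a diagonal
  number, possibly negative, becomes a translation in the group.\<close>

lemma natmul_plus_zmul:
  assumes "0 \<le> int n + k"
  shows "natmul n x + zmul k x = natmul (nat (int n + k)) x"
proof (cases "0 \<le> k")
  case True
  then show ?thesis
    by (simp add: zmul_def nat_add_distrib natmul_add)
next
  case False
  define m where "m = nat (- k)"
  have "k = - int m" and "m \<le> n" using False assms by (auto simp: m_def)
  moreover have "natmul n x = natmul (n - m) x + natmul m x"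
    using \<open>m \<le> n\<close> natmul_add[of "n - m" m x] by simp
  moreover have "nat (int n + k) = n - m" using calculation by auto
  ultimately show ?thesis using False by (simp add: zmul_def)
qed

text \<open>Tube lemma: the condition is open in \<open>(y, z)\<close> and holds on
  \<open>{x} \<times> UNIV\<close>, so compactness in \<open>z\<close> yields one \<open>W\<close>.
  This uniformity makes all twisted means of \<open>f\<close> equicontinuous at once, whatever the
  frequency and the length.\<close>

lemma translates_equicontinuous:
  fixes f :: "'g::topological_ab_group_add \<Rightarrow> complex"
  assumes comp: "compact (UNIV :: 'g set)" and f: "continuous_on UNIV f" and e: "e > 0"
  obtains W where "open W" "x \<in> W" "\<And>y z. y \<in> W \<Longrightarrow> cmod (f (y + z) - f (x + z)) < e"
proof -
  define P where "P = {p::'g \<times> 'g. cmod (f (fst p + snd p) - f (x + snd p)) < e}"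
  have "continuous_on UNIV (\<lambda>p::'g \<times> 'g. cmod (f (fst p + snd p) - f (x + snd p)))"
    by (intro continuous_intros continuous_on_compose2[OF f]) auto
  then have "open P"
    unfolding P_def by (rule open_Collect_less) (rule continuous_on_const)
  then have "openin (prod_topology euclidean euclidean) P"
    by (simp add: prod_topology_euclidean)
  moreover have "compactin euclidean (UNIV :: 'g set)"
    using comp by simp
  moreover have "{x} \<times> UNIV \<subseteq> P"
    using e by (auto simp: P_def)
  ultimately obtain W V where "open W" "x \<in> W" "UNIV \<subseteq> V" "W \<times> V \<subseteq> P"
    using tube_lemma_right[of euclidean euclidean P UNIV x] by auto
  with that[of W] show ?thesis
    by (force simp: P_def)
qed

text \<open>The function spaces met below need not be metrizable, so a sequence in them may lack
  convergent subsequences. A filter finer than \<open>sequentially\<close> takes the place of a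
  subsequence.\<close>

lemma compact_cluster_filter:
  fixes s :: "nat \<Rightarrow> 'a::topological_space"
  assumes "compact K" "\<And>j. s j \<in> K"
  obtains F l where "F \<le> sequentially" "F \<noteq> bot" "l \<in> K" "(s \<longlongrightarrow> l) F"
proof -
  have "filtermap s sequentially \<noteq> bot"
    by (simp add: filtermap_bot_iff)
  moreover have "eventually (\<lambda>x. x \<in> K) (filtermap s sequentially)"
    using assms by (simp add: eventually_filtermap)
  ultimately obtain l where l: "l \<in> K" "inf (nhds l) (filtermap s sequentially) \<noteq> bot"
    using assms(1) unfolding compact_filter by blast
  \<comment> \<open>Nontrivial because \<open>s\<close> enters every neighbourhood of the cluster
    point \<open>l\<close> infinitely often.\<close>
  define F where "F = inf sequentially (filtercomap s (nhds l))"
  have "F \<noteq> bot"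
  proof
    assume "F = bot"
    then obtain P Q where PQ: "eventually P sequentially" "eventually Q (filtercomap s (nhds l))"
        "\<And>x. P x \<Longrightarrow> Q x \<Longrightarrow> False"
      unfolding F_def trivial_limit_def eventually_inf by blast
    obtain R where R: "eventually R (nhds l)" "\<And>x. R (s x) \<Longrightarrow> Q x"
      using PQ(2) unfolding eventually_filtercomap by blast
    have "eventually (\<lambda>x. \<not> R x) (filtermap s sequentially)"
      unfolding eventually_filtermap by (rule eventually_mono[OF PQ(1)]) (use PQ(3) R(2) in blast)
    with R(1) have "inf (nhds l) (filtermap s sequentially) = bot"
      unfolding trivial_limit_def eventually_inf by blast
    with l show False by simp
  qed
  moreover have "(s \<longlongrightarrow> l) F"
    unfolding F_def filterlim_def
    by (meson filtermap_filtercomap filtermap_mono inf_le2 order_trans)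
  moreover have "F \<le> sequentially" by (simp add: F_def)
  ultimately show ?thesis using that l(1) by blast
qed

text \<open>Tychonoff: a product of closed discs, in the topology of pointwise convergence.\<close>

lemma compact_bounded_functions:
  "compact {g :: 'a \<Rightarrow> complex. \<forall>x. cmod (g x) \<le> B}"
proof -
  have "compactin (product_topology (\<lambda>_::'a. euclidean::complex topology) UNIV) (PiE UNIV (\<lambda>_. cball 0 B))"
    by (subst compactin_PiE) auto
  moreover have "PiE UNIV (\<lambda>_::'a. cball (0::complex) B) = {g. \<forall>x. cmod (g x) \<le> B}"
    by (auto simp: PiE_def)
  ultimately show ?thesis
    by (simp add: euclidean_product_topology)
qed

section \<open>Twisted ergodic means and their cluster points\<close>

definition twisted_mean :: "'g::ab_group_add \<Rightarrow> ('g \<Rightarrow> complex) \<Rightarrow> complex \<Rightarrow> nat \<Rightarrow> 'g \<Rightarrow> complex" where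
  "twisted_mean x1 f l N x = (\<Sum>n<N. f (x + natmul n x1) * l ^ n) / of_nat N"

lemma norm_mean_le:
  fixes h :: "nat \<Rightarrow> complex"
  assumes "\<And>n. cmod (h n) \<le> B" "0 \<le> B"
  shows "cmod ((\<Sum>n<N. h n) / of_nat N) \<le> B"
proof (cases "N = 0")
  case False
  have "cmod (\<Sum>n<N. h n) \<le> (\<Sum>n<N. B)"
    using assms by (intro sum_norm_le) auto
  with False show ?thesis by (simp add: norm_divide field_simps)
qed (use assms in auto)

lemma twisted_mean_diff_le:
  assumes "cmod l = 1" "\<And>z. cmod (f (x + z) - f (y + z)) \<le> e" "0 \<le> e"
  shows "cmod (twisted_mean x1 f l N x - twisted_mean x1 f l N y) \<le> e"
proof -
  have "twisted_mean x1 f l N x - twisted_mean x1 f l N y =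
      (\<Sum>n<N. (f (x + natmul n x1) - f (y + natmul n x1)) * l ^ n) / of_nat N"
    by (simp add: twisted_mean_def algebra_simps sum_subtractf diff_divide_distrib)
  also have "cmod \<dots> \<le> e"
    using assms by (intro norm_mean_le) (auto simp: norm_mult norm_power)
  finally show ?thesis .
qed

text \<open>The sum telescopes, so only the two end terms survive and the defect is of order
  \<open>1 / N\<close>. Hence every cluster point \<open>g\<close> of the means satisfies
  \<open>m * g (x + x1) = g x\<close>.\<close>

lemma twisted_mean_shift:
  "l * twisted_mean x1 f l N (x + x1) - twisted_mean x1 f l N x =
     (f (x + natmul N x1) * l ^ N - f x) / of_nat N"
proof -
  let ?t = "\<lambda>n. f (x + natmul n x1) * l ^ n"
  have "l * (\<Sum>n<N. f (x + x1 + natmul n x1) * l ^ n) = (\<Sum>n<N. ?t (Suc n))"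
    by (simp add: sum_distrib_left algebra_simps)
  then have "l * (\<Sum>n<N. f (x + x1 + natmul n x1) * l ^ n) - (\<Sum>n<N. ?t n) = ?t N - ?t 0"
    using sum_lessThan_telescope[of ?t N] by (simp only: sum_subtractf[symmetric])
  then show ?thesis
    by (simp add: twisted_mean_def diff_divide_distrib[symmetric])
qed

lemma continuous_bounded:
  fixes f :: "'g::topological_space \<Rightarrow> complex"
  assumes "compact (UNIV :: 'g set)" "continuous_on UNIV f"
  obtains C where "\<And>x. cmod (f x) \<le> C"
proof -
  have "bounded (f ` UNIV)"
    using assms compact_continuous_image compact_imp_bounded by blast
  with that show ?thesis by (auto simp: bounded_iff)
qed

text \<open>Frequency and mean are put into one compact product, the circle times the bounded
  functions, so that both converge along the same filter. Pointwise limits suffice: continuity of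
  \<open>g\<close> comes from equicontinuity of the means, and its functional equation from
  \<open>twisted_mean_shift\<close>.\<close>

lemma twisted_mean_cluster:
  fixes f :: "'g::topological_ab_group_add \<Rightarrow> complex" and l :: "nat \<Rightarrow> complex" and N :: "nat \<Rightarrow> nat"
  assumes comp: "compact (UNIV :: 'g set)" and f: "continuous_on UNIV f"
    and l: "\<And>j. cmod (l j) = 1" and N: "filterlim N at_top sequentially"
  obtains F m g where "F \<le> sequentially" "F \<noteq> bot" "cmod m = 1" "(l \<longlongrightarrow> m) F"
    "\<forall>x. ((\<lambda>j. twisted_mean x1 f (l j) (N j) x) \<longlongrightarrow> g x) F"
    "continuous_on UNIV g" "\<forall>x. m * g (x + x1) = g x"
proof -
  obtain B where B: "\<And>x. cmod (f x) \<le> B" "0 \<le> B"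
    using continuous_bounded[OF comp f] by (meson norm_ge_zero order_trans)
  define s where "s j = (l j, \<lambda>x. twisted_mean x1 f (l j) (N j) x)" for j
  let ?K = "sphere (0::complex) 1 \<times> {g :: 'g \<Rightarrow> complex. \<forall>x. cmod (g x) \<le> B}"
  have "compact ?K"
    by (intro compact_Times compact_bounded_functions compact_sphere)
  moreover have "s j \<in> ?K" for j
    using l B unfolding s_def twisted_mean_def
    by (auto intro!: norm_mean_le simp: norm_mult norm_power)
  ultimately obtain F k where F: "F \<le> sequentially" "F \<noteq> bot" "k \<in> ?K" "(s \<longlongrightarrow> k) F"
    by (rule compact_cluster_filter)
  define m g where "m = fst k" and "g = snd k"
  have m: "cmod m = 1" using F(3) by (auto simp: m_def)
  have lm: "(l \<longlongrightarrow> m) F"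
    using tendsto_fst[OF F(4)] by (simp add: s_def m_def)
  have "((\<lambda>j. snd (s j)) \<longlongrightarrow> g) F"
    using tendsto_snd[OF F(4)] by (simp add: g_def)
  have ev: "((\<lambda>j. twisted_mean x1 f (l j) (N j) x) \<longlongrightarrow> g x) F" for x
  proof -
    have "((\<lambda>j. snd (s j) x) \<longlongrightarrow> g x) F"
      by (rule continuous_on_tendsto_compose[OF continuous_on_product_coordinates
            \<open>((\<lambda>j. snd (s j)) \<longlongrightarrow> g) F\<close>]) auto
    then show ?thesis by (simp add: s_def)
  qed
  have "continuous_on UNIV g"
    unfolding continuous_on_def
  proof
    fix x
    show "(g \<longlongrightarrow> g x) (at x)"
      unfolding tendsto_iff
    proof (intro allI impI)
      fix e :: real assume "e > 0"
      then obtain W where W: "open W" "x \<in> W" "\<And>y z. y \<in> W \<Longrightarrow> cmod (f (y + z) - f (x + z)) < e/2"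
        using translates_equicontinuous[OF comp f, of "e/2"] by (metis half_gt_zero)
      have "dist (g y) (g x) < e" if "y \<in> W" for y
      proof -
        have "((\<lambda>j. twisted_mean x1 f (l j) (N j) y - twisted_mean x1 f (l j) (N j) x) \<longlongrightarrow> g y - g x) F"
          by (intro tendsto_intros ev)
        moreover have "cmod (twisted_mean x1 f (l j) (N j) y - twisted_mean x1 f (l j) (N j) x) \<le> e/2" for j
          using W(3)[OF that] \<open>e > 0\<close> by (intro twisted_mean_diff_le l) (auto intro: less_imp_le)
        ultimately have "cmod (g y - g x) \<le> e/2"
          using F(2) by (intro Lim_norm_ubound[of F]) auto
        with \<open>e > 0\<close> show ?thesis by (simp add: dist_norm)
      qed
      then show "\<forall>\<^sub>F y in at x. dist (g y) (g x) < e"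
        unfolding eventually_at_topological using W(1,2) by blast
    qed
  qed
  moreover have "m * g (x + x1) = g x" for x
  proof -
    let ?D = "\<lambda>j. l j * twisted_mean x1 f (l j) (N j) (x + x1) - twisted_mean x1 f (l j) (N j) x"
    have "(?D \<longlongrightarrow> m * g (x + x1) - g x) F"
      by (intro tendsto_intros ev lm)
    moreover have "(?D \<longlongrightarrow> 0) F"
    \<comment> \<open>The defect is \<open>O(1 / N j)\<close> along \<open>sequentially\<close>, and
      \<open>F\<close> is finer.\<close>
    proof (rule tendsto_mono[OF F(1)], rule Lim_null_comparison)
      have "cmod (?D j) \<le> 2 * B / real (N j)" for j
      proof -
        have "cmod (f (x + natmul (N j) x1) * l j ^ N j - f x) \<le> B + B"
          by (rule order_trans[OF norm_triangle_ineq4]) (use l B(1)[of x] B(1)[of "x + natmul (N j) x1"] in \<open>simp add: norm_mult norm_power\<close>)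
        then show ?thesis
          unfolding twisted_mean_shift by (auto simp: norm_divide intro: divide_right_mono)
      qed
      then show "\<forall>\<^sub>F j in sequentially. cmod (?D j) \<le> 2 * B / real (N j)" by simp
      have "filterlim (\<lambda>j. real (N j)) at_top sequentially"
        using N filterlim_compose filterlim_real_sequentially by blast
      then show "(\<lambda>j. 2 * B / real (N j)) \<longlonglongrightarrow> 0"
        by (intro tendsto_divide_0[OF tendsto_const] filterlim_at_top_imp_at_infinity)
    qed
    ultimately have "m * g (x + x1) - g x = 0"
      by (rule tendsto_unique[OF F(2)])
    then show ?thesis by simp
  qed
  ultimately show ?thesis
    using ev by (intro that[OF F(1,2) m lm]) auto
qed

lemma character_0 [simp]: "character ch \<Longrightarrow> ch 0 = 1"
proof -
  assume "character ch"
  then have "ch (0 + 0) = ch 0 * ch 0" "cmod (ch 0) = 1" unfolding character_def by blast+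
  then show ?thesis by auto
qed

lemma character_natmul: "character ch \<Longrightarrow> ch (natmul n x) = ch x ^ n"
  by (induction n) (auto, auto simp: character_def)

section \<open>Consequences of the density of the orbit\<close>

locale monothetic =
  fixes x1 :: "'g::{topological_ab_group_add, t2_space}"
  assumes compact_group: "compact (UNIV :: 'g set)"
    and dense: "closure (range (\<lambda>n::int. zmul n x1)) = UNIV"
begin

lemma dense_closed:
  assumes "closed S" "\<And>n. natmul n x1 \<in> S" "\<And>n. - natmul n x1 \<in> S"
  shows "x \<in> S"
proof -
  have "range (\<lambda>n::int. zmul n x1) \<subseteq> S"
    using assms by (auto simp: zmul_def)
  then show ?thesis
    using closure_minimal[OF _ assms(1)] dense by blast
qed

text \<open>Iterating the hypothesis expresses \<open>g (x \<plusminus> natmul n x1)\<close> as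
  \<open>g x\<close> times a power of \<open>m\<close>, which settles both claims on the dense
  subgroup; both are closed conditions. The identity is left unnormalized because \<open>g\<close>
  may vanish identically.\<close>

lemma quasi_invariant_multiplicative:
  assumes g: "continuous_on UNIV g" and m: "cmod m = 1" and inv: "\<And>x. m * g (x + x1) = g x"
  shows "g (x + y) * g 0 = g x * g y" "cmod (g x) = cmod (g 0)"
proof -
  have m0: "m \<noteq> 0" using m by auto
  have pos: "m ^ n * g (x + natmul n x1) = g x" for n x
  proof (induction n arbitrary: x)
    case (Suc n)
    show ?case using Suc[of "x + x1"] inv[of x] by (simp add: algebra_simps)
  qed auto
  have neg: "g (x - natmul n x1) = m ^ n * g x" for n x
    using pos[of n "x - natmul n x1"] by simp
  have *: "g (x + natmul n x1) = g x / m ^ n" for n x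
    using pos[of n x] m0 by (simp add: field_simps)
  show "g (x + y) * g 0 = g x * g y"
  proof -
    have "closed {y. g (x + y) * g 0 = g x * g y}"
      by (intro closed_Collect_eq continuous_on_mult continuous_on_compose2[OF g] continuous_on_add
          continuous_on_const continuous_on_id) auto
    then have "y \<in> {y. g (x + y) * g 0 = g x * g y}"
    proof (rule dense_closed)
      fix n
      show "natmul n x1 \<in> {y. g (x + y) * g 0 = g x * g y}"
        using *[of x n] *[of 0 n] by simp
      show "- natmul n x1 \<in> {y. g (x + y) * g 0 = g x * g y}"
        using neg[of x n] neg[of 0 n] by simp
    qed
    then show ?thesis by simp
  qed
  have "closed {x. cmod (g x) = cmod (g 0)}"
    by (intro closed_Collect_eq continuous_intros g)
  then have "x \<in> {x. cmod (g x) = cmod (g 0)}"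
  proof (rule dense_closed)
    fix n
    show "natmul n x1 \<in> {x. cmod (g x) = cmod (g 0)}"
      using *[of 0 n] m by (simp add: norm_divide norm_power)
    show "- natmul n x1 \<in> {x. cmod (g x) = cmod (g 0)}"
      using neg[of 0 n] m by (simp add: norm_mult norm_power)
  qed
  then show "cmod (g x) = cmod (g 0)" by simp
qed

text \<open>Constant modulus excludes \<open>g 0 = 0\<close>, since then \<open>g y\<close> would
  vanish as well; dividing by \<open>g 0\<close> turns \<open>g\<close> into a character.\<close>

lemma quasi_invariant_character:
  assumes g: "continuous_on UNIV g" and m: "cmod m = 1" and inv: "\<And>x. m * g (x + x1) = g x"
    and nz: "g y \<noteq> g 0"
  obtains ch where "character ch" "ch y \<noteq> 1"
proof
  have g0: "g 0 \<noteq> 0"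
    using quasi_invariant_multiplicative(2)[OF g m inv, of y] nz by auto
  show "character (\<lambda>x. g x / g 0)"
    unfolding character_def
    using quasi_invariant_multiplicative[OF g m inv] g0
    by (auto intro!: continuous_intros g simp: norm_divide divide_simps)
  show "g y / g 0 \<noteq> 1" using g0 nz by simp
qed

text \<open>By density and compactness finitely many translates \<open>U k\<close> of
  \<open>V\<close> cover the group. If \<open>B\<close> bounds the \<open>\<bar>k\<bar>\<close>, a
  point of the orbit reaches \<open>V\<close> within \<open>B\<close> steps forwards or
  backwards.\<close>

lemma syndetic_returns:
  assumes V: "open V" "0 \<in> V"
  obtains L where "0 < L" "\<And>q. \<exists>t. q * L \<le> t \<and> t < Suc q * L \<and> natmul t x1 \<in> V"
proof -
  define U where "U k = {y. y + zmul k x1 \<in> V}" for k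
  have "open (U k)" for k
  proof -
    have "open ((\<lambda>y. y + zmul k x1) -` V)"
      using V(1) by (intro open_vimage continuous_intros)
    then show ?thesis by (simp add: U_def vimage_def)
  qed
  moreover have "UNIV \<subseteq> (\<Union>k. U k)"
  proof
    fix y :: 'g
    have "open ((\<lambda>z. y + z) -` V)"
      using V(1) by (intro open_vimage continuous_intros)
    moreover have "- y \<in> (\<lambda>z. y + z) -` V" using V(2) by simp
    ultimately have "range (\<lambda>n. zmul n x1) \<inter> (\<lambda>z. y + z) -` V \<noteq> {}"
      using dense open_Int_closure_eq_empty[of "(\<lambda>z. y + z) -` V" "range (\<lambda>n. zmul n x1)"] by blast
    then show "y \<in> (\<Union>k. U k)" by (auto simp: U_def)
  qed
  ultimately obtain K where K: "finite K" "UNIV \<subseteq> (\<Union>k\<in>K. U k)"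
    using compactE_image[OF compact_group, of UNIV U] by auto
  define B where "B = nat (Max (insert 0 (abs ` K)))"
  have B: "\<bar>k\<bar> \<le> int B" if "k \<in> K" for k
    using that K(1) by (auto simp: B_def intro!: Max_ge)
  show ?thesis
  proof
    show "0 < 2 * B + 1" by simp
    fix q
    \<comment> \<open>The middle of the \<open>q\<close>-th block of length
      \<open>2 * B + 1\<close>: a displacement of at most \<open>B\<close> stays inside the
      block.\<close>
    let ?n = "q * (2 * B + 1) + B"
    obtain k where k: "k \<in> K" "natmul ?n x1 \<in> U k" using K(2) by blast
    have "natmul ?n x1 + zmul k x1 = natmul (nat (int ?n + k)) x1"
    proof (rule natmul_plus_zmul)
      have "0 \<le> int (q * (2 * B + 1))" by simp
      then show "0 \<le> int ?n + k" using B[OF k(1)] by linarith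
    qed
    with k(2) have "natmul (nat (int ?n + k)) x1 \<in> V" by (simp add: U_def)
    moreover have "q * (2 * B + 1) \<le> nat (int ?n + k)" "nat (int ?n + k) < Suc q * (2 * B + 1)"
    proof -
      have "int (q * (2 * B + 1)) \<le> int ?n + k" "int ?n + k < int (Suc q * (2 * B + 1))"
        using B[OF k(1)] by (auto simp: algebra_simps)
      then show "q * (2 * B + 1) \<le> nat (int ?n + k)" "nat (int ?n + k) < Suc q * (2 * B + 1)"
        by linarith+
    qed
    ultimately show "\<exists>t. q * (2 * B + 1) \<le> t \<and> t < Suc q * (2 * B + 1) \<and> natmul t x1 \<in> V"
      by blast
  qed
qed

text \<open>With all frequencies equal to 1 a cluster point is invariant under translation by
  \<open>x1\<close>, hence constant by density. Its value is \<open>c\<close>, fixed before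
  \<open>e\<close>; equicontinuity and a finite cover turn closeness at the points of
  \<open>P\<close> into a bound uniform in \<open>x\<close>.\<close>

lemma uniform_mean:
  fixes f :: "'g \<Rightarrow> complex"
  assumes f: "continuous_on UNIV f"
  obtains c where "\<And>e. e > 0 \<Longrightarrow> \<exists>N>0. \<forall>x. cmod ((\<Sum>n<N. f (x + natmul n x1)) / of_nat N - c) \<le> e"
proof -
  have "filterlim Suc at_top sequentially"
    by (rule filterlim_Suc)
  then obtain F g m where F: "F \<le> sequentially" "F \<noteq> bot" "cmod m = 1" "((\<lambda>_. 1) \<longlongrightarrow> m) F"
    and evs: "\<forall>x. ((\<lambda>j. twisted_mean x1 f 1 (Suc j) x) \<longlongrightarrow> g x) F"
    and gs: "continuous_on UNIV g" "\<forall>x. m * g (x + x1) = g x"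
    by (rule twisted_mean_cluster[where l = "\<lambda>_. 1" and N = Suc and ?x1.0 = x1, OF compact_group f norm_one])
  note ev = spec[OF evs] and g = gs(1) spec[OF gs(2)]
  have m: "m = 1"
    using tendsto_unique[OF F(2,4) tendsto_const] .
  have shift: "g (natmul n x1) = g 0" for n
  proof (induction n)
    case (Suc n) then show ?case using g(2)[of "natmul n x1"] m by (simp add: add.commute)
  qed auto
  have shift': "g (- natmul n x1) = g 0" for n
  proof (induction n)
    case (Suc n) then show ?case using g(2)[of "- natmul (Suc n) x1"] m by simp
  qed auto
  have "closed {x. g x = g 0}"
    by (intro closed_Collect_eq g(1) continuous_on_const)
  then have const: "g x = g 0" for x
    using dense_closed[of "{x. g x = g 0}" x] shift shift' by auto
  show ?thesis
  proof
    fix e :: real assume e: "e > 0"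
    have "\<exists>W. open W \<and> x \<in> W \<and> (\<forall>y\<in>W. \<forall>z. cmod (f (y + z) - f (x + z)) < e/2)" for x
      using translates_equicontinuous[OF compact_group f, of "e/2" x] e by (metis half_gt_zero)
    then obtain W where W: "\<And>x. open (W x)" "\<And>x. x \<in> W x"
        "\<And>x y z. y \<in> W x \<Longrightarrow> cmod (f (y + z) - f (x + z)) < e/2"
      by metis
    have "UNIV \<subseteq> (\<Union>p. W p)" using W(2) by blast
    then obtain P where P: "finite P" "UNIV \<subseteq> (\<Union>p\<in>P. W p)"
      using compactE_image[OF compact_group, of UNIV W] W(1) by metis
    have "\<forall>\<^sub>F j in F. \<forall>p\<in>P. dist (twisted_mean x1 f 1 (Suc j) p) (g p) < e/2"
      using e by (intro eventually_ball_finite[OF P(1)] ballI tendstoD[OF ev]) simp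
    then obtain j where j: "\<And>p. p \<in> P \<Longrightarrow> dist (twisted_mean x1 f 1 (Suc j) p) (g p) < e/2"
      using F(2) eventually_happens by blast
    have "cmod (twisted_mean x1 f 1 (Suc j) x - g 0) \<le> e" for x
    proof -
      obtain p where p: "p \<in> P" "x \<in> W p" using P(2) by blast
      have "cmod (twisted_mean x1 f 1 (Suc j) x - twisted_mean x1 f 1 (Suc j) p) \<le> e/2"
        using W(3)[OF p(2)] e by (intro twisted_mean_diff_le) (auto intro: less_imp_le)
      moreover have "cmod (twisted_mean x1 f 1 (Suc j) p - g 0) < e/2"
        using j[OF p(1)] const[of p] by (simp add: dist_norm)
      ultimately show ?thesis
        using norm_triangle_ineq[of "twisted_mean x1 f 1 (Suc j) x - twisted_mean x1 f 1 (Suc j) p"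
            "twisted_mean x1 f 1 (Suc j) p - g 0"] by simp
    qed
    then show "\<exists>N>0. \<forall>x. cmod ((\<Sum>n<N. f (x + natmul n x1)) / of_nat N - g 0) \<le> e"
      unfolding twisted_mean_def by (intro exI[of _ "Suc j"]) auto
  qed
qed

end

section \<open>Finite Fourier analysis on the integers modulo N\<close>

lemma dft_orthogonality:
  fixes N p q :: nat
  assumes "p < N" "q < N"
  shows "(\<Sum>k<N. cis (2 * pi * real p / real N) ^ k * cnj (cis (2 * pi * real q / real N) ^ k)) =
    (if p = q then of_nat N else 0)"
proof -
  define z where "z = cis (2 * pi * real p / real N) * cnj (cis (2 * pi * real q / real N))"
  have "(\<Sum>k<N. cis (2 * pi * real p / real N) ^ k * cnj (cis (2 * pi * real q / real N) ^ k)) = (\<Sum>k<N. z ^ k)"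
    by (simp add: z_def power_mult_distrib)
  also have "\<dots> = (if p = q then of_nat N else 0)"
  proof (cases "p = q")
    case True
    then have "z = 1" by (simp add: z_def cis_cnj cis_mult)
    with True show ?thesis by simp
  next
    case False
    have inj: "inj_on (\<lambda>k. cis (2 * pi * real k / real N)) {..<N}"
      using Complex.bij_betw_roots_unity[of N] assms by (simp add: bij_betw_def)
    have "z \<noteq> 1"
    proof
      assume "z = 1"
      then have "z * cis (2 * pi * real q / real N) = cis (2 * pi * real q / real N)" by simp
      then have "cis (2 * pi * real p / real N) = cis (2 * pi * real q / real N)"
        by (simp add: z_def cis_cnj cis_mult)
      with inj assms False show False by (auto dest: inj_onD)
    qed
    moreover have "z ^ N = 1"
      using assms cis_multiple_2pi[of "real p"] cis_multiple_2pi[of "real q"]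
      by (simp add: z_def power_mult_distrib Complex.DeMoivre flip: complex_cnj_power)
    ultimately show ?thesis using False by (simp add: geometric_sum)
  qed
  finally show ?thesis .
qed

text \<open>Fourier inversion and Parseval on \<open>\<int>/N\<close> bound the sum of \<open>h (p + q)\<close> over \<open>T \<times> T\<close> by
  \<open>card T\<close> times the largest Fourier coefficient; \<open>2 * t < N\<close> prevents wrap-around of \<open>p + q\<close>.\<close>

lemma large_fourier_coefficient:
  fixes h :: "nat \<Rightarrow> complex" and T :: "nat set"
  assumes N: "0 < N" and T: "\<And>t. t \<in> T \<Longrightarrow> 2 * t < N" "T \<noteq> {}"
    and C: "\<And>p q. p \<in> T \<Longrightarrow> q \<in> T \<Longrightarrow> C \<le> Re (h (p + q))"
  obtains l where "cmod l = 1" "C * real (card T) \<le> cmod (\<Sum>n<N. h n * l ^ n)"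
proof -
  define w where "w k = cis (2 * pi * real k / real N)" for k
  have fT: "finite T"
    by (rule finite_subset[of _ "{..<N}"]) (use T(1) in force)+
  have normw: "cmod (w k) = 1" for k by (simp add: w_def)
  \<comment> \<open>Frequency and exponent enter symmetrically; this turns
    \<open>dft_orthogonality\<close>, a sum over exponents, into a sum over frequencies.\<close>
  have sym: "w k ^ n = w n ^ k" for k n by (simp add: w_def Complex.DeMoivre mult.commute mult.left_commute)
  \<comment> \<open>\<open>H\<close> holds the unnormalized Fourier coefficients of
    \<open>h\<close>, and \<open>S\<close> the exponential sums of \<open>T\<close>.\<close>
  define H where "H k = (\<Sum>n<N. h n * cnj (w k) ^ n)" for k
  define S where "S k = (\<Sum>p\<in>T. w k ^ p)" for k
  have orth: "(\<Sum>k<N. w k ^ p * cnj (w k) ^ q) = (if p = q then of_nat N else 0)" if "p < N" "q < N" for p q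
    using dft_orthogonality[OF that] by (simp add: sym[of _ p] sym[of _ q] flip: w_def complex_cnj_power)
  have inv: "of_nat N * h s = (\<Sum>k<N. H k * w k ^ s)" if "s < N" for s
  proof -
    have "(\<Sum>k<N. H k * w k ^ s) = (\<Sum>n<N. h n * (\<Sum>k<N. w k ^ s * cnj (w k) ^ n))"
      unfolding H_def sum_distrib_left sum_distrib_right by (subst sum.swap) (simp add: mult_ac)
    also have "\<dots> = (\<Sum>n<N. if n = s then h n * of_nat N else 0)"
      using orth[OF that] by (intro sum.cong) auto
    finally show ?thesis using that by (simp add: mult.commute)
  qed
  have bil: "of_nat N * (\<Sum>p\<in>T. \<Sum>q\<in>T. h (p + q)) = (\<Sum>k<N. H k * (S k)\<^sup>2)"
  proof -
    have "of_nat N * (\<Sum>p\<in>T. \<Sum>q\<in>T. h (p + q)) = (\<Sum>p\<in>T. \<Sum>q\<in>T. \<Sum>k<N. H k * (w k ^ p * w k ^ q))"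
      unfolding sum_distrib_left
    proof (intro sum.cong refl)
      fix p q assume "p \<in> T" "q \<in> T"
      then have "p + q < N" using T(1)[of p] T(1)[of q] by linarith
      then show "of_nat N * h (p + q) = (\<Sum>k<N. H k * (w k ^ p * w k ^ q))"
        by (simp add: inv power_add)
    qed
    also have "\<dots> = (\<Sum>k<N. \<Sum>p\<in>T. \<Sum>q\<in>T. H k * (w k ^ p * w k ^ q))"
      by (subst (2) sum.swap, subst sum.swap) simp
    also have "\<dots> = (\<Sum>k<N. H k * (S k)\<^sup>2)"
      by (simp add: S_def power2_eq_square sum_product) (simp add: sum_distrib_left)
    finally show ?thesis .
  qed
  have pars: "(\<Sum>k<N. (cmod (S k))\<^sup>2) = real N * real (card T)"
  proof -
    have "complex_of_real (\<Sum>k<N. (cmod (S k))\<^sup>2) = (\<Sum>k<N. \<Sum>p\<in>T. \<Sum>q\<in>T. w k ^ p * cnj (w k) ^ q)"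
      by (simp add: complex_norm_square S_def sum_product flip: of_real_power)
    also have "\<dots> = (\<Sum>p\<in>T. \<Sum>q\<in>T. \<Sum>k<N. w k ^ p * cnj (w k) ^ q)"
      by (subst sum.swap, subst (2) sum.swap) simp
    also have "\<dots> = (\<Sum>p\<in>T. \<Sum>q\<in>T. if q = p then of_nat N else 0)"
    proof (intro sum.cong refl)
      fix p q assume "p \<in> T" "q \<in> T"
      then have "p < N" "q < N" using T(1)[of p] T(1)[of q] by linarith+
      then show "(\<Sum>k<N. w k ^ p * cnj (w k) ^ q) = (if q = p then of_nat N else 0)"
        using orth by auto
    qed
    also have "\<dots> = complex_of_real (real N * real (card T))"
      using fT by (simp add: mult.commute)
    finally show ?thesis by (simp only: of_real_eq_iff)
  qed
  define M where "M = Max ((\<lambda>k. cmod (H k)) ` {..<N})"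
  have "M \<in> (\<lambda>k. cmod (H k)) ` {..<N}"
    unfolding M_def using N by (intro Max_in) auto
  then obtain k where k: "M = cmod (H k)" by auto
  have HM: "cmod (H k) \<le> M" if "k < N" for k
    unfolding M_def using that by (intro Max_ge) auto
  \<comment> \<open>The double sum has real part at least \<open>C * (card T)\<^sup>2\<close> and,
    by Parseval, modulus at most \<open>M * card T\<close>; cancelling one factor
    \<open>card T\<close> gives the claim.\<close>
  have "real N * (C * real (card T) * real (card T)) \<le> real N * Re (\<Sum>p\<in>T. \<Sum>q\<in>T. h (p + q))"
  proof (rule mult_left_mono)
    have "(\<Sum>p\<in>T. \<Sum>q\<in>T. C) \<le> (\<Sum>p\<in>T. \<Sum>q\<in>T. Re (h (p + q)))"
      by (intro sum_mono C)
    then show "C * real (card T) * real (card T) \<le> Re (\<Sum>p\<in>T. \<Sum>q\<in>T. h (p + q))"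
      by (simp add: mult_ac)
  qed simp
  also have "\<dots> = Re (\<Sum>k<N. H k * (S k)\<^sup>2)"
    unfolding bil[symmetric] by simp
  also have "\<dots> \<le> cmod (\<Sum>k<N. H k * (S k)\<^sup>2)" by (rule complex_Re_le_cmod)
  also have "\<dots> \<le> (\<Sum>k<N. M * (cmod (S k))\<^sup>2)"
    by (intro sum_norm_le) (auto simp: norm_mult norm_power intro!: mult_right_mono HM)
  also have "\<dots> = real N * (M * real (card T))"
    by (simp add: sum_distrib_left[symmetric] pars)
  finally have "C * real (card T) * real (card T) \<le> M * real (card T)"
    using N by simp
  then have "C * real (card T) \<le> M"
    using T(2) fT by (simp add: card_gt_0_iff)
  with that[of "cnj (w k)"] normw k show ?thesis
    by (simp add: H_def)
qed

section \<open>Separation of points by characters\<close>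

context monothetic
begin

lemma separating_function:
  assumes "y \<noteq> (0 :: 'g)"
  obtains f :: "'g \<Rightarrow> real" where "continuous_on UNIV f" "f 0 = 0" "f y = 1"
proof -
  have "Hausdorff_space (euclidean :: 'g topology)"
    unfolding Hausdorff_space_def by (auto simp: disjnt_def) (metis hausdorff)
  moreover have "compact_space (euclidean :: 'g topology)"
    using compact_group by (simp add: compact_space_def)
  ultimately have "normal_space (euclidean :: 'g topology)"
    using compact_Hausdorff_or_regular_imp_normal_space by blast
  then obtain f where "continuous_map euclidean euclideanreal f" "f ` {0::'g} \<subseteq> {0}" "f ` {y} \<subseteq> {1}"
    using Urysohn_lemma_alt[of "euclidean :: 'g topology" "{0}" "{y}" 0 1] assms by auto
  with that show ?thesis by auto
qed

lemma characters_separate: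
  assumes y: "y \<noteq> (0 :: 'g)"
  obtains ch where "character ch" "ch y \<noteq> 1"
proof -
  obtain fr :: "'g \<Rightarrow> real" where fr: "continuous_on UNIV fr" "fr 0 = 0" "fr y = 1"
    using separating_function[OF y] .
  define f where "f x = complex_of_real (fr x)" for x
  have f: "continuous_on UNIV f"
    unfolding f_def by (intro continuous_intros fr)
  define h where "h x = f (x + y) - f x" for x
  have h: "continuous_on UNIV (\<lambda>p::'g \<times> 'g. Re (h (fst p + snd p)))"
    unfolding h_def
    by (intro continuous_on_Re continuous_on_diff continuous_on_compose2[OF f] continuous_on_add
        continuous_on_fst continuous_on_snd continuous_on_id continuous_on_const) auto
  \<comment> \<open>\<open>h 0 = 1\<close>, so \<open>Re (h (p + q))\<close> stays above 1/2 for
    \<open>p\<close> and \<open>q\<close> near 0. The condition is put on sums because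
    \<open>large_fourier_coefficient\<close> evaluates \<open>h\<close> at sums of return
    times.\<close>
  have "open {p::'g \<times> 'g. 1/2 < Re (h (fst p + snd p))}"
    by (rule open_Collect_less[OF continuous_on_const h])
  moreover have "(0,0) \<in> {p::'g \<times> 'g. 1/2 < Re (h (fst p + snd p))}"
    by (simp add: h_def f_def fr)
  ultimately obtain V1 V2 where V12: "open V1" "open V2" "(0,0) \<in> V1 \<times> V2"
      "V1 \<times> V2 \<subseteq> {p::'g \<times> 'g. 1/2 < Re (h (fst p + snd p))}"
    by (rule open_prod_elim)
  define V where "V = V1 \<inter> V2"
  have V: "open V" "0 \<in> V" "\<And>p q. p \<in> V \<Longrightarrow> q \<in> V \<Longrightarrow> 1/2 \<le> Re (h (p + q))"
    using V12 by (auto simp: V_def intro!: less_imp_le)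
  obtain L where L: "0 < L" "\<And>q. \<exists>t. q * L \<le> t \<and> t < Suc q * L \<and> natmul t x1 \<in> V"
    using syndetic_returns[OF V(1,2)] by blast
  then obtain t where t: "\<And>q. q * L \<le> t q" "\<And>q. t q < Suc q * L" "\<And>q. natmul (t q) x1 \<in> V"
    by metis
  \<comment> \<open>One return time per block, so the first \<open>Suc j\<close> of them are
    distinct.\<close>
  have "t p < t q" if "p < q" for p q
  proof -
    have "t p < Suc p * L" by (rule t)
    also have "\<dots> \<le> q * L" using that by (intro mult_le_mono1) simp
    also have "\<dots> \<le> t q" by (rule t)
    finally show ?thesis .
  qed
  then have "strict_mono t" by (simp add: strict_mono_def)
  then have inj: "inj t" by (rule strict_mono_imp_inj_on)
  \<comment> \<open>Twice the total length of the first \<open>Suc j\<close> blocks, as the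
    condition \<open>2 * s < N j\<close> against wrap-around demands.\<close>
  define N where "N j = 2 * (Suc j * L)" for j
  have "\<exists>l. cmod l = 1 \<and> 1/2 * real (Suc j) \<le> cmod (\<Sum>n<N j. h (natmul n x1) * l ^ n)" for j
  proof -
    have "\<And>s. s \<in> t ` {..j} \<Longrightarrow> 2 * s < N j"
    proof -
      fix s assume "s \<in> t ` {..j}"
      then obtain q where q: "q \<le> j" "s = t q" by auto
      have "t q < Suc q * L" by (rule t)
      also have "\<dots> \<le> Suc j * L" using q by (intro mult_le_mono1) simp
      finally show "2 * s < N j" by (simp add: q N_def)
    qed
    moreover have "0 < N j" using L by (simp add: N_def)
    moreover have "1/2 \<le> Re (h (natmul (p + q) x1))" if "p \<in> t ` {..j}" "q \<in> t ` {..j}" for p q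
      using that t(3) V(3) by (auto simp: natmul_add)
    moreover have "card (t ` {..j}) = Suc j"
      using inj by (simp add: card_image inj_on_subset)
    moreover have "t ` {..j} \<noteq> {}" by auto
    ultimately obtain l where "cmod l = 1" "1/2 * real (card (t ` {..j})) \<le> cmod (\<Sum>n<N j. h (natmul n x1) * l ^ n)"
      using large_fourier_coefficient[of "N j" "t ` {..j}" "1/2" "\<lambda>n. h (natmul n x1)"] by blast
    with \<open>card (t ` {..j}) = Suc j\<close> show ?thesis by metis
  qed
  then obtain l where l: "\<And>j. cmod (l j) = 1"
      "\<And>j. 1/2 * real (Suc j) \<le> cmod (\<Sum>n<N j. h (natmul n x1) * l j ^ n)"
    by metis
  have "filterlim N at_top sequentially"
  proof (rule filterlim_at_top_mono[OF filterlim_ident], rule always_eventually, rule allI)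
    fix j
    have "j \<le> j * L" using L by (cases L) auto
    then have "j \<le> Suc j * L" by (simp add: trans_le_add2)
    then show "j \<le> N j" unfolding N_def by linarith
  qed
  then obtain F g m where F: "F \<le> sequentially" "F \<noteq> bot" "cmod m = 1" "(l \<longlongrightarrow> m) F"
    and evs: "\<forall>x. ((\<lambda>j. twisted_mean x1 f (l j) (N j) x) \<longlongrightarrow> g x) F"
    and gs: "continuous_on UNIV g" "\<forall>x. m * g (x + x1) = g x"
    by (rule twisted_mean_cluster[where l = l and ?x1.0 = x1, OF compact_group f l(1)])
  note ev = spec[OF evs] and g = gs(1) spec[OF gs(2)]
  \<comment> \<open>The \<open>Suc j\<close> return times make up the fraction
    \<open>1 / (2 * L)\<close> of \<open>N j\<close>, and 1/2 bounds \<open>Re h\<close> at their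
    sums; the product does not depend on \<open>j\<close> and so survives in the limit.\<close>
  have low: "1 / (4 * real L) \<le> cmod (twisted_mean x1 f (l j) (N j) y - twisted_mean x1 f (l j) (N j) 0)" for j
  proof -
    have "twisted_mean x1 f (l j) (N j) y - twisted_mean x1 f (l j) (N j) 0 =
        (\<Sum>n<N j. h (natmul n x1) * l j ^ n) / of_nat (N j)"
      by (simp add: twisted_mean_def h_def diff_divide_distrib[symmetric] sum_subtractf[symmetric] algebra_simps)
    then have "cmod (twisted_mean x1 f (l j) (N j) y - twisted_mean x1 f (l j) (N j) 0) =
        cmod (\<Sum>n<N j. h (natmul n x1) * l j ^ n) / real (N j)"
      by (simp add: norm_divide)
    also have "\<dots> \<ge> (1/2 * real (Suc j)) / real (N j)"
      by (intro divide_right_mono l(2)) simp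
    also have "(1/2 * real (Suc j)) / real (N j) = 1 / (4 * real L)"
    proof -
      have "real (N j) = 2 * real (Suc j) * real L" by (simp add: N_def algebra_simps)
      then show ?thesis using L(1) by (simp del: of_nat_Suc)
    qed
    finally show ?thesis .
  qed
  have "((\<lambda>j. cmod (twisted_mean x1 f (l j) (N j) y - twisted_mean x1 f (l j) (N j) 0)) \<longlongrightarrow> cmod (g y - g 0)) F"
    by (intro tendsto_intros ev)
  then have "1 / (4 * real L) \<le> cmod (g y - g 0)"
    using low F(2) by (intro tendsto_lowerbound[of _ _ F]) auto
  moreover have "1 / (4 * real L) > 0" using L(1) by simp
  ultimately have "g y \<noteq> g 0" by auto
  then show ?thesis
    using quasi_invariant_character[OF g(1) F(3) g(2)] that by blast
qed

text \<open>Otherwise the orbit would be finite, hence closed, and by density the whole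
  group.\<close>

lemma natmul_nonzero:
  assumes inf: "infinite (UNIV :: 'g set)" and n: "0 < n"
  shows "natmul n x1 \<noteq> 0"
proof
  assume 0: "natmul n x1 = 0"
  define S where "S = (\<lambda>k. natmul k x1) ` {..<n}"
  have per: "natmul (q * n) x1 = 0" for q
    by (induction q) (auto simp: natmul_add 0)
  have red: "natmul k x1 \<in> S" for k
  proof -
    have "natmul k x1 = natmul (k div n * n) x1 + natmul (k mod n) x1"
      by (metis div_mult_mod_eq natmul_add)
    then show ?thesis using per n by (auto simp: S_def)
  qed
  have "- natmul k x1 \<in> S" for k
  proof -
    have "natmul (k * n) x1 = natmul (k * n - k) x1 + natmul k x1"
      using n by (simp flip: natmul_add)
    then have "- natmul k x1 = natmul (k * n - k) x1"
      using per by (simp add: minus_unique add.commute)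
    then show ?thesis using red by simp
  qed
  moreover have "closed S" "finite S" by (auto simp: S_def intro!: finite_imp_closed)
  ultimately have "S = UNIV"
    using dense_closed[of S] red by blast
  with inf \<open>finite S\<close> show False by simp
qed

lemma exists_character_aperiodic:
  assumes "infinite (UNIV :: 'g set)" "0 < n"
  obtains ch where "character ch" "ch x1 ^ n \<noteq> 1"
proof -
  obtain ch where ch: "character ch" "ch (natmul n x1) \<noteq> 1"
    using characters_separate natmul_nonzero[OF assms] by blast
  then show ?thesis using that character_natmul[of ch] by auto
qed

end

section \<open>Norm bounds for matrices\<close>

text \<open>A bound for the sesquilinear form on finite sections, homogeneous in \<open>v\<close>
  and \<open>w\<close>. Unlike the supremum \<open>opnorm\<close>, which is meaningful only under
  \<open>bounded_op\<close>, it passes directly through sums, scalars, adjoints and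
  products.\<close>

definition op_bound :: "real \<Rightarrow> mat \<Rightarrow> bool" where
  "op_bound C T \<longleftrightarrow> 0 \<le> C \<and> (\<forall>F v w. finite F \<longrightarrow>
     cmod (\<Sum>i\<in>F. \<Sum>j\<in>F. cnj (w i) * T i j * v j) \<le>
       C * L2_set (\<lambda>j. cmod (v j)) F * L2_set (\<lambda>i. cmod (w i)) F)"

lemma op_bound_nonneg: "op_bound C T \<Longrightarrow> 0 \<le> C"
  by (simp add: op_bound_def)

lemma L2_set_le_1_iff: "L2_set f F \<le> 1 \<longleftrightarrow> (\<Sum>j\<in>F. (f j)\<^sup>2) \<le> 1"
  by (simp add: L2_set_def real_sqrt_le_1_iff)

lemma op_bound_imp_opnorm_le:
  assumes "op_bound C T"
  shows "bounded_op T" "opnorm T \<le> C"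
proof -
  have *: "x \<le> C" if x: "x \<in> opnorm_set T" for x
  proof -
    obtain F v w where F: "finite F" "L2_set (\<lambda>j. cmod (v j)) F \<le> 1" "L2_set (\<lambda>i. cmod (w i)) F \<le> 1"
      and x: "x = cmod (\<Sum>i\<in>F. \<Sum>j\<in>F. cnj (w i) * T i j * v j)"
      using x unfolding opnorm_set_def L2_set_le_1_iff by blast
    have "x \<le> C * L2_set (\<lambda>j. cmod (v j)) F * L2_set (\<lambda>i. cmod (w i)) F"
      using assms F(1) unfolding op_bound_def x by blast
    also have "\<dots> \<le> C * 1 * 1"
      using assms F by (intro mult_mono) (auto simp: op_bound_def)
    finally show ?thesis by simp
  qed
  show "bounded_op T"
    unfolding bounded_op_def bdd_above_def using * by blast
  have "opnorm_set T \<noteq> {}"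
    unfolding opnorm_set_def by (auto intro!: exI[of _ "{}"])
  then show "opnorm T \<le> C"
    unfolding opnorm_def using * by (rule cSup_least)
qed

text \<open>Rescale \<open>v\<close> and \<open>w\<close> to unit vectors; if one of them vanishes
  on \<open>F\<close>, so does the form.\<close>

lemma bounded_op_imp_op_bound:
  assumes "bounded_op T"
  shows "op_bound (opnorm T) T"
proof -
  have ub: "x \<le> opnorm T" if "x \<in> opnorm_set T" for x
    unfolding opnorm_def using assms that by (intro cSup_upper) (auto simp: bounded_op_def)
  have "0 \<in> opnorm_set T"
    unfolding opnorm_set_def by (auto intro!: exI[of _ "{}"])
  then have n0: "0 \<le> opnorm T" by (rule ub)
  moreover have "cmod (\<Sum>i\<in>F. \<Sum>j\<in>F. cnj (w i) * T i j * v j) \<le>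
       opnorm T * L2_set (\<lambda>j. cmod (v j)) F * L2_set (\<lambda>i. cmod (w i)) F" if F: "finite F" for F v w
  proof (cases "L2_set (\<lambda>j. cmod (v j)) F = 0 \<or> L2_set (\<lambda>i. cmod (w i)) F = 0")
    case True
    then have "(\<forall>j\<in>F. v j = 0) \<or> (\<forall>i\<in>F. w i = 0)"
      using F by (simp add: L2_set_eq_0_iff)
    then have "(\<Sum>i\<in>F. \<Sum>j\<in>F. cnj (w i) * T i j * v j) = 0"
      by (auto intro!: sum.neutral)
    then show ?thesis using n0 by simp
  next
    case False
    define a b where "a = L2_set (\<lambda>j. cmod (v j)) F" and "b = L2_set (\<lambda>i. cmod (w i)) F"
    have ab: "0 < a" "0 < b"
      using False by (auto simp: a_def b_def less_le)
    have sa: "(\<Sum>j\<in>F. (cmod (v j))\<^sup>2) = a\<^sup>2" "(\<Sum>i\<in>F. (cmod (w i))\<^sup>2) = b\<^sup>2"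
      by (auto simp: a_def b_def L2_set_def sum_nonneg)
    have "cmod (\<Sum>i\<in>F. \<Sum>j\<in>F. cnj (w i / b) * T i j * (v j / a)) \<in> opnorm_set T"
      unfolding opnorm_set_def mem_Collect_eq
    proof (intro exI conjI)
      show "(\<Sum>j\<in>F. (cmod (v j / a))\<^sup>2) \<le> 1"
        using ab sa by (simp add: norm_divide power_divide flip: sum_divide_distrib)
      show "(\<Sum>i\<in>F. (cmod (w i / b))\<^sup>2) \<le> 1"
        using ab sa by (simp add: norm_divide power_divide flip: sum_divide_distrib)
    qed (use F in auto)
    then have "cmod (\<Sum>i\<in>F. \<Sum>j\<in>F. cnj (w i / b) * T i j * (v j / a)) \<le> opnorm T" by (rule ub)
    moreover have "(\<Sum>i\<in>F. \<Sum>j\<in>F. cnj (w i / b) * T i j * (v j / a)) =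
        (\<Sum>i\<in>F. \<Sum>j\<in>F. cnj (w i) * T i j * v j) / (of_real a * of_real b)"
      by (simp add: sum_divide_distrib mult_ac)
    ultimately have "cmod (\<Sum>i\<in>F. \<Sum>j\<in>F. cnj (w i) * T i j * v j) / (a * b) \<le> opnorm T"
      using ab by (simp add: norm_divide norm_mult)
    then show ?thesis
      using ab by (simp add: divide_le_eq mult_ac flip: a_def b_def)
  qed
  ultimately show ?thesis unfolding op_bound_def by blast
qed

lemma bounded_op_iff: "bounded_op T \<longleftrightarrow> (\<exists>C. op_bound C T)"
  using op_bound_imp_opnorm_le(1) bounded_op_imp_op_bound by blast

lemma op_bound_mono: "op_bound C T \<Longrightarrow> C \<le> D \<Longrightarrow> op_bound D T"
proof -
  assume T: "op_bound C T" and CD: "C \<le> D"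
  have "C * L2_set (\<lambda>j. cmod (v j)) F * L2_set (\<lambda>i. cmod (w i)) F
      \<le> D * L2_set (\<lambda>j. cmod (v j)) F * L2_set (\<lambda>i. cmod (w i)) F" for F and v w :: "nat \<Rightarrow> complex"
    using CD by (intro mult_right_mono L2_set_nonneg)
  then show ?thesis
    using T CD unfolding op_bound_def by (meson order_trans)
qed

lemma op_bound_add:
  assumes "op_bound C S" "op_bound D T"
  shows "op_bound (C + D) (madd S T)"
  unfolding op_bound_def
proof (intro conjI allI impI)
  show "0 \<le> C + D" using assms by (simp add: op_bound_def)
  fix F :: "nat set" and v w :: "nat \<Rightarrow> complex"
  assume F: "finite F"
  have "(\<Sum>i\<in>F. \<Sum>j\<in>F. cnj (w i) * madd S T i j * v j) =
      (\<Sum>i\<in>F. \<Sum>j\<in>F. cnj (w i) * S i j * v j) + (\<Sum>i\<in>F. \<Sum>j\<in>F. cnj (w i) * T i j * v j)"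
    by (simp add: madd_def algebra_simps sum.distrib)
  also have "cmod \<dots> \<le> C * L2_set (\<lambda>j. cmod (v j)) F * L2_set (\<lambda>i. cmod (w i)) F +
      D * L2_set (\<lambda>j. cmod (v j)) F * L2_set (\<lambda>i. cmod (w i)) F"
    using assms F unfolding op_bound_def by (intro norm_triangle_le add_mono) blast+
  finally show "cmod (\<Sum>i\<in>F. \<Sum>j\<in>F. cnj (w i) * madd S T i j * v j) \<le>
      (C + D) * L2_set (\<lambda>j. cmod (v j)) F * L2_set (\<lambda>i. cmod (w i)) F"
    by (simp add: algebra_simps)
qed

lemma op_bound_smult:
  assumes "op_bound C T"
  shows "op_bound (cmod c * C) (msmult c T)"
  unfolding op_bound_def
proof (intro conjI allI impI)
  show "0 \<le> cmod c * C" using assms by (simp add: op_bound_def)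
  fix F :: "nat set" and v w :: "nat \<Rightarrow> complex"
  assume F: "finite F"
  have "(\<Sum>i\<in>F. \<Sum>j\<in>F. cnj (w i) * msmult c T i j * v j) =
      c * (\<Sum>i\<in>F. \<Sum>j\<in>F. cnj (w i) * T i j * v j)"
    by (simp add: msmult_def sum_distrib_left mult_ac)
  also have "cmod \<dots> \<le> cmod c * (C * L2_set (\<lambda>j. cmod (v j)) F * L2_set (\<lambda>i. cmod (w i)) F)"
    using assms F unfolding op_bound_def norm_mult by (intro mult_left_mono) auto
  finally show "cmod (\<Sum>i\<in>F. \<Sum>j\<in>F. cnj (w i) * msmult c T i j * v j) \<le>
      cmod c * C * L2_set (\<lambda>j. cmod (v j)) F * L2_set (\<lambda>i. cmod (w i)) F"
    by (simp add: algebra_simps)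
qed

lemma msub_conv: "msub S T = madd S (msmult (-1) T)"
  by (simp add: msub_def madd_def msmult_def)

lemma op_bound_sub: "op_bound C S \<Longrightarrow> op_bound D T \<Longrightarrow> op_bound (C + D) (msub S T)"
  unfolding msub_conv using op_bound_smult[of D T "-1"] by (auto intro: op_bound_add)

lemma op_bound_adj:
  assumes "op_bound C T"
  shows "op_bound C (madj T)"
  unfolding op_bound_def
proof (intro conjI allI impI)
  show "0 \<le> C" using assms by (simp add: op_bound_def)
  fix F :: "nat set" and v w :: "nat \<Rightarrow> complex"
  assume F: "finite F"
  have "(\<Sum>i\<in>F. \<Sum>j\<in>F. cnj (w i) * madj T i j * v j) = cnj (\<Sum>i\<in>F. \<Sum>j\<in>F. cnj (v i) * T i j * w j)"
    by (subst sum.swap) (simp add: madj_def mult_ac)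
  then have "cmod (\<Sum>i\<in>F. \<Sum>j\<in>F. cnj (w i) * madj T i j * v j) =
      cmod (\<Sum>i\<in>F. \<Sum>j\<in>F. cnj (v i) * T i j * w j)"
    by (simp only: complex_mod_cnj)
  also have "\<dots> \<le> C * L2_set (\<lambda>j. cmod (w j)) F * L2_set (\<lambda>i. cmod (v i)) F"
    using assms F unfolding op_bound_def by blast
  finally show "cmod (\<Sum>i\<in>F. \<Sum>j\<in>F. cnj (w i) * madj T i j * v j) \<le>
      C * L2_set (\<lambda>j. cmod (v j)) F * L2_set (\<lambda>i. cmod (w i)) F"
    by (simp only: mult_ac)
qed

text \<open>Extending both vectors by zero to \<open>F \<union> G\<close> reduces a rectangular
  section to a square one.\<close>

lemma op_bound_two:
  assumes T: "op_bound C T" and F: "finite F" and G: "finite G"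
  shows "cmod (\<Sum>i\<in>F. \<Sum>j\<in>G. cnj (w i) * T i j * v j) \<le>
       C * L2_set (\<lambda>j. cmod (v j)) G * L2_set (\<lambda>i. cmod (w i)) F"
proof -
  define v' where "v' j = (if j \<in> G then v j else 0)" for j
  define w' where "w' i = (if i \<in> F then w i else 0)" for i
  have "(\<Sum>i\<in>F. \<Sum>j\<in>G. cnj (w i) * T i j * v j) = (\<Sum>i\<in>F \<union> G. \<Sum>j\<in>F \<union> G. cnj (w' i) * T i j * v' j)"
    using F G by (intro sum.mono_neutral_cong_left) (auto simp: v'_def w'_def intro!: sum.mono_neutral_cong_left)
  moreover have "L2_set (\<lambda>j. cmod (v' j)) (F \<union> G) = L2_set (\<lambda>j. cmod (v j)) G"
    unfolding L2_set_def using F G by (intro arg_cong[where f = sqrt] sum.mono_neutral_cong_right) (auto simp: v'_def)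
  moreover have "L2_set (\<lambda>j. cmod (w' j)) (F \<union> G) = L2_set (\<lambda>j. cmod (w j)) F"
    unfolding L2_set_def using F G by (intro arg_cong[where f = sqrt] sum.mono_neutral_cong_right) (auto simp: w'_def)
  moreover have "cmod (\<Sum>i\<in>F \<union> G. \<Sum>j\<in>F \<union> G. cnj (w' i) * T i j * v' j) \<le>
      C * L2_set (\<lambda>j. cmod (v' j)) (F \<union> G) * L2_set (\<lambda>i. cmod (w' i)) (F \<union> G)"
    using T F G unfolding op_bound_def by blast
  ultimately show ?thesis by simp
qed

lemma op_bound_entry:
  assumes "op_bound C T"
  shows "cmod (T i j) \<le> C"
  using op_bound_two[OF assms, of "{i}" "{j}" "\<lambda>_. 1" "\<lambda>_. 1"] by simp

lemma op_boundI:
  assumes "\<And>F v w. finite F \<Longrightarrow> (\<Sum>j\<in>F. (cmod (v j))\<^sup>2) \<le> 1 \<Longrightarrow> (\<Sum>i\<in>F. (cmod (w i))\<^sup>2) \<le> 1 \<Longrightarrow>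
    cmod (\<Sum>i\<in>F. \<Sum>j\<in>F. cnj (w i) * T i j * v j) \<le> C"
  shows "op_bound C T"
proof -
  have "x \<le> C" if "x \<in> opnorm_set T" for x
    using that assms unfolding opnorm_set_def by auto
  then have "bounded_op T" "opnorm T \<le> C"
    unfolding bounded_op_def bdd_above_def opnorm_def
    by (blast, intro cSup_least) (auto simp: opnorm_set_def intro!: exI[of _ "{}"])
  then show ?thesis
    by (rule op_bound_mono[OF bounded_op_imp_op_bound])
qed

text \<open>Schur test. By \<open>2 * s * t \<le> s\<^sup>2 + t\<^sup>2\<close> each entry is
  charged half to its row and half to its column.\<close>

lemma op_bound_schur:
  assumes R: "0 \<le> R" and rows: "\<And>i F. finite F \<Longrightarrow> (\<Sum>j\<in>F. cmod (T i j)) \<le> R"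
    and cols: "\<And>j F. finite F \<Longrightarrow> (\<Sum>i\<in>F. cmod (T i j)) \<le> R"
  shows "op_bound R T"
proof (rule op_boundI)
  fix F :: "nat set" and v w :: "nat \<Rightarrow> complex"
  assume F: "finite F" "(\<Sum>j\<in>F. (cmod (v j))\<^sup>2) \<le> 1" "(\<Sum>i\<in>F. (cmod (w i))\<^sup>2) \<le> 1"
  let ?x = "cmod (\<Sum>i\<in>F. \<Sum>j\<in>F. cnj (w i) * T i j * v j)"
  have "?x \<le> (\<Sum>i\<in>F. \<Sum>j\<in>F. cmod (cnj (w i) * T i j * v j))"
    by (intro sum_norm_le order_trans[OF norm_sum]) auto
  also have "\<dots> \<le> (\<Sum>i\<in>F. \<Sum>j\<in>F. (cmod (w i))\<^sup>2 * cmod (T i j) / 2 + (cmod (v j))\<^sup>2 * cmod (T i j) / 2)"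
  proof (intro sum_mono)
    fix i j
    have "cmod (w i) * cmod (v j) \<le> ((cmod (w i))\<^sup>2 + (cmod (v j))\<^sup>2) / 2"
      using sum_squares_bound[of "cmod (w i)" "cmod (v j)"] by simp
    from mult_right_mono[OF this norm_ge_zero[of "T i j"]]
    show "cmod (cnj (w i) * T i j * v j) \<le> (cmod (w i))\<^sup>2 * cmod (T i j) / 2 + (cmod (v j))\<^sup>2 * cmod (T i j) / 2"
      by (simp add: norm_mult field_simps)
  qed
  also have "\<dots> = (\<Sum>i\<in>F. (cmod (w i))\<^sup>2 * (\<Sum>j\<in>F. cmod (T i j))) / 2 +
      (\<Sum>j\<in>F. (cmod (v j))\<^sup>2 * (\<Sum>i\<in>F. cmod (T i j))) / 2"
  proof -
    have "(\<Sum>i\<in>F. \<Sum>j\<in>F. (cmod (v j))\<^sup>2 * cmod (T i j) / 2) = (\<Sum>j\<in>F. \<Sum>i\<in>F. (cmod (v j))\<^sup>2 * cmod (T i j) / 2)"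
      by (rule sum.swap)
    then show ?thesis
      by (simp add: sum.distrib sum_distrib_left sum_divide_distrib)
  qed
  also have "\<dots> \<le> (\<Sum>i\<in>F. (cmod (w i))\<^sup>2 * R) / 2 + (\<Sum>j\<in>F. (cmod (v j))\<^sup>2 * R) / 2"
    using F(1) by (intro add_mono divide_right_mono sum_mono mult_left_mono rows cols) auto
  also have "\<dots> = R * (((\<Sum>i\<in>F. (cmod (w i))\<^sup>2) + (\<Sum>j\<in>F. (cmod (v j))\<^sup>2)) / 2)"
    by (simp only: sum_distrib_right[symmetric]) (simp add: algebra_simps add_divide_distrib)
  also have "\<dots> \<le> R * 1"
    using F R by (intro mult_left_mono) auto
  finally show "?x \<le> R" by simp
qed

section \<open>Band matrices\<close>

definition banded :: "nat \<Rightarrow> mat \<Rightarrow> bool" where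
  "banded B T \<longleftrightarrow> (\<forall>i j. T i j \<noteq> 0 \<longrightarrow> i \<le> j + B \<and> j \<le> i + B)"

lemma bandedD: "banded B T \<Longrightarrow> i > j + B \<Longrightarrow> T i j = 0" "banded B T \<Longrightarrow> j > i + B \<Longrightarrow> T i j = 0"
  unfolding banded_def by (meson leD)+

lemma banded_mono: "banded B T \<Longrightarrow> B \<le> B' \<Longrightarrow> banded B' T"
  unfolding banded_def by (meson add_left_mono order_trans)

lemma banded_op_bound:
  assumes b: "banded B T" and C: "\<And>i j. cmod (T i j) \<le> C"
  shows "op_bound (real (2 * B + 1) * C) T"
proof (rule op_bound_schur)
  have C0: "0 \<le> C" using C[of 0 0] norm_ge_zero order_trans by blast
  then show "0 \<le> real (2 * B + 1) * C" by simp
  have *: "(\<Sum>j\<in>F. cmod (f j)) \<le> real (2 * B + 1) * C"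
    if F: "finite F" and f: "\<And>j. f j \<noteq> 0 \<Longrightarrow> i \<le> j + B \<and> j \<le> i + B" "\<And>j. cmod (f j) \<le> C"
    for F i and f :: "nat \<Rightarrow> complex"
  proof -
    have "(\<Sum>j\<in>F. cmod (f j)) = (\<Sum>j\<in>F \<inter> {i - B..i + B}. cmod (f j))"
      using F f(1) by (intro sum.mono_neutral_right) force+
    also have "\<dots> \<le> (\<Sum>j\<in>{i - B..i + B}. cmod (f j))"
      by (intro sum_mono2) auto
    also have "\<dots> \<le> (\<Sum>j\<in>{i - B..i + B}. C)"
      by (intro sum_mono f)
    also have "\<dots> \<le> real (2 * B + 1) * C"
    proof -
      have "Suc (i + B) - (i - B) \<le> 2 * B + 1" by auto
      then have "real (Suc (i + B) - (i - B)) \<le> real (2 * B + 1)" by (simp only: of_nat_le_iff)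
      then show ?thesis using C0 by (auto intro!: mult_right_mono simp del: of_nat_add of_nat_mult)
    qed
    finally show ?thesis .
  qed
  show "(\<Sum>j\<in>F. cmod (T i j)) \<le> real (2 * B + 1) * C" if "finite F" for i F
    by (rule *[OF that, of "T i" i]) (use b C in \<open>auto simp: banded_def\<close>)
  show "(\<Sum>i\<in>F. cmod (T i j)) \<le> real (2 * B + 1) * C" if "finite F" for j F
    by (rule *[OF that, of "\<lambda>i. T i j" j]) (use b C in \<open>auto simp: banded_def\<close>)
qed

text \<open>A single diagonal has at most one nonzero entry per row and column, so the Schur test
  gives the entry bound itself, without a factor. This makes \<open>dpart\<close> a
  contraction.\<close>

lemma op_bound_homogeneous:
  assumes n: "\<And>i j. T i j \<noteq> 0 \<Longrightarrow> int i - int j = n" and C: "\<And>i j. cmod (T i j) \<le> C"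
  shows "op_bound C T"
proof (rule op_bound_schur)
  show C0: "0 \<le> C" using C[of 0 0] norm_ge_zero order_trans by blast
  have *: "(\<Sum>j\<in>F. cmod (f j)) \<le> C"
    if F: "finite F" and f: "\<And>j k. f j \<noteq> 0 \<Longrightarrow> f k \<noteq> 0 \<Longrightarrow> j = k" "\<And>j. cmod (f j) \<le> C"
    for F and f :: "nat \<Rightarrow> complex"
  proof (cases "\<exists>k\<in>F. f k \<noteq> 0")
    case True
    then obtain k where k: "k \<in> F" "f k \<noteq> 0" by blast
    have "(\<Sum>j\<in>F. cmod (f j)) = (\<Sum>j\<in>{k}. cmod (f j))"
      using F k f(1) by (intro sum.mono_neutral_right) auto
    then show ?thesis using f(2) by simp
  qed (use C0 in auto)
  show "(\<Sum>j\<in>F. cmod (T i j)) \<le> C" if "finite F" for i F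
    using that
  proof (rule *)
    show "T i j \<noteq> 0 \<Longrightarrow> T i k \<noteq> 0 \<Longrightarrow> j = k" for j k using n[of i j] n[of i k] by simp
  qed (rule C)
  show "(\<Sum>i\<in>F. cmod (T i j)) \<le> C" if "finite F" for j F
    using that
  proof (rule *)
    show "T i j \<noteq> 0 \<Longrightarrow> T k j \<noteq> 0 \<Longrightarrow> i = k" for i k using n[of i j] n[of k j] by simp
  qed (rule C)
qed

lemma mmult_right:
  assumes "finite K" "\<And>k. k \<notin> K \<Longrightarrow> S k j = 0"
  shows "mmult T S i j = (\<Sum>k\<in>K. T i k * S k j)"
  unfolding mmult_def using assms by (intro suminf_finite) auto

lemma mmult_left:
  assumes "finite K" "\<And>k. k \<notin> K \<Longrightarrow> S i k = 0"
  shows "mmult S T i j = (\<Sum>k\<in>K. S i k * T k j)"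
  unfolding mmult_def using assms by (intro suminf_finite) auto

lemma mmult_banded_right: "banded B S \<Longrightarrow> j + B < M \<Longrightarrow> mmult T S i j = (\<Sum>k<M. T i k * S k j)"
  by (rule mmult_right) (auto simp: bandedD)

lemma mmult_banded_left: "banded B S \<Longrightarrow> i + B < M \<Longrightarrow> mmult S T i j = (\<Sum>k<M. S i k * T k j)"
  by (rule mmult_left) (auto simp: bandedD)

lemma banded_mult:
  assumes "banded B S" "banded C T"
  shows "banded (B + C) (mmult S T)"
  unfolding banded_def
proof (intro allI impI)
  fix i j assume "mmult S T i j \<noteq> 0"
  then have "(\<Sum>k<Suc (i + B). S i k * T k j) \<noteq> 0"
    using mmult_banded_left[OF assms(1), of i "Suc (i + B)"] by simp
  then obtain k where "S i k * T k j \<noteq> 0"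
    by (rule sum.not_neutral_contains_not_neutral)
  then have "S i k \<noteq> 0" "T k j \<noteq> 0" by auto
  then have "i \<le> k + B \<and> k \<le> i + B" "k \<le> j + C \<and> j \<le> k + C"
    using assms unfolding banded_def by blast+
  then show "i \<le> j + (B + C) \<and> j \<le> i + (B + C)" by auto
qed

lemma banded_add: "banded B S \<Longrightarrow> banded C T \<Longrightarrow> banded (B + C) (madd S T)"
proof -
  assume "banded B S" "banded C T"
  then have "banded (B + C) S" "banded (B + C) T" by (auto elim: banded_mono)
  then show ?thesis unfolding banded_def madd_def by (metis add_0)
qed

lemma banded_smult: "banded B S \<Longrightarrow> banded B (msmult c S)"
  unfolding banded_def msmult_def by auto

lemma banded_adj: "banded B S \<Longrightarrow> banded B (madj S)"
  unfolding banded_def madj_def by auto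

lemma madj_mmult: "banded B S \<Longrightarrow> madj (mmult T S) = mmult (madj S) (madj T)"
proof (intro ext)
  fix i j assume "banded B S"
  then show "madj (mmult T S) i j = mmult (madj S) (madj T) i j"
    using mmult_banded_right[of B S i "Suc (i + B)" T j] mmult_banded_left[OF banded_adj, of B S i "Suc (i + B)" "madj T" j]
    by (simp add: madj_def mult_ac)
qed

text \<open>The band of \<open>S\<close> makes the vector \<open>u = S v\<close> finitely supported,
  so the bound for \<open>T\<close> on finite sections applies to it.\<close>

lemma op_bound_mult_right:
  assumes T: "op_bound t T" and S: "op_bound b S" and band: "banded B S"
  shows "op_bound (t * b) (mmult T S)"
  unfolding op_bound_def
proof (intro conjI allI impI)
  have tb: "0 \<le> t" "0 \<le> b" using T S by (auto simp: op_bound_def)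
  then show "0 \<le> t * b" by simp
  fix F :: "nat set" and v w :: "nat \<Rightarrow> complex"
  assume F: "finite F"
  then obtain m where m: "\<And>j. j \<in> F \<Longrightarrow> j \<le> m"
    using finite_nat_set_iff_bounded_le by auto
  \<comment> \<open>No row of \<open>S\<close> from \<open>M\<close> on meets a column in
    \<open>F\<close>, so truncating at \<open>M\<close> loses nothing.\<close>
  define M where "M = Suc (m + B)"
  define u where "u k = (\<Sum>j\<in>F. S k j * v j)" for k
  let ?L = "L2_set (\<lambda>k. cmod (u k)) {..<M}" and ?v = "L2_set (\<lambda>j. cmod (v j)) F"
    and ?w = "L2_set (\<lambda>i. cmod (w i)) F"
  \<comment> \<open>Testing \<open>S\<close> against \<open>u\<close> itself gives
    \<open>?L\<^sup>2 \<le> b * ?v * ?L\<close>, whence \<open>?L \<le> b * ?v\<close>.\<close>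
  have "complex_of_real (?L\<^sup>2) = (\<Sum>k<M. cnj (u k) * u k)"
    by (simp add: L2_set_def sum_nonneg complex_norm_square mult.commute del: of_real_power)
  also have "\<dots> = (\<Sum>k<M. \<Sum>j\<in>F. cnj (u k) * S k j * v j)"
    by (subst (2) u_def) (simp add: sum_distrib_left mult_ac)
  finally have "?L\<^sup>2 = cmod (\<Sum>k<M. \<Sum>j\<in>F. cnj (u k) * S k j * v j)"
    by (metis abs_of_nonneg norm_of_real zero_le_power2)
  also have "\<dots> \<le> b * ?v * ?L"
    using op_bound_two[OF S _ F] by blast
  finally have "?L * ?L \<le> (b * ?v) * ?L" by (simp add: power2_eq_square)
  then have Lb: "?L \<le> b * ?v"
    using tb by (cases "?L = 0") (auto simp: L2_set_nonneg less_le)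
  have "(\<Sum>i\<in>F. \<Sum>j\<in>F. cnj (w i) * mmult T S i j * v j) =
      (\<Sum>i\<in>F. \<Sum>j\<in>F. \<Sum>k<M. cnj (w i) * T i k * (S k j * v j))"
  proof (intro sum.cong refl)
    fix i j assume "j \<in> F"
    then have "j + B < M" using m by (auto simp: M_def intro!: le_imp_less_Suc)
    then show "cnj (w i) * mmult T S i j * v j = (\<Sum>k<M. cnj (w i) * T i k * (S k j * v j))"
      by (simp add: mmult_banded_right[OF band] sum_distrib_left sum_distrib_right mult_ac)
  qed
  also have "\<dots> = (\<Sum>i\<in>F. \<Sum>k<M. cnj (w i) * T i k * u k)"
    by (subst sum.swap[of _ "{..<M}"]) (simp add: u_def sum_distrib_left)
  also have "cmod \<dots> \<le> t * ?L * ?w"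
    by (rule op_bound_two[OF T F]) simp
  also have "\<dots> \<le> t * (b * ?v) * ?w"
    using Lb tb by (intro mult_right_mono mult_left_mono) (auto simp: L2_set_nonneg)
  finally show "cmod (\<Sum>i\<in>F. \<Sum>j\<in>F. cnj (w i) * mmult T S i j * v j) \<le> t * b * ?v * ?w"
    by (simp add: mult_ac)
qed

lemma madj_madj [simp]: "madj (madj T) = T"
  by (simp add: madj_def)

lemma op_bound_mult_left:
  assumes T: "op_bound t T" and S: "op_bound b S" and band: "banded B S"
  shows "op_bound (t * b) (mmult S T)"
proof -
  have "op_bound (t * b) (madj (mmult (madj T) (madj S)))"
    by (intro op_bound_adj op_bound_mult_right[where B = B] banded_adj assms)
  then show ?thesis
    using madj_mmult[OF banded_adj[OF band], of "madj T"] by simp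
qed

section \<open>Commutators with band matrices\<close>

lemma mmult_add_right:
  assumes "banded B S" "banded C T"
  shows "mmult X (madd S T) = madd (mmult X S) (mmult X T)"
proof (intro ext)
  fix i j
  let ?M = "Suc (j + (B + C))"
  have "mmult X S i j = (\<Sum>k<?M. X i k * S k j)" "mmult X T i j = (\<Sum>k<?M. X i k * T k j)"
    "mmult X (madd S T) i j = (\<Sum>k<?M. X i k * madd S T k j)"
    by (rule mmult_banded_right[OF assms(1)] mmult_banded_right[OF assms(2)] mmult_banded_right[OF banded_add[OF assms]]; simp)+
  then show "mmult X (madd S T) i j = madd (mmult X S) (mmult X T) i j"
    by (simp add: madd_def sum.distrib algebra_simps del: sum.lessThan_Suc)
qed

lemma mmult_add_left:
  assumes "banded B S" "banded C T"
  shows "mmult (madd S T) X = madd (mmult S X) (mmult T X)"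
proof (intro ext)
  fix i j
  let ?M = "Suc (i + (B + C))"
  have "mmult S X i j = (\<Sum>k<?M. S i k * X k j)" "mmult T X i j = (\<Sum>k<?M. T i k * X k j)"
    "mmult (madd S T) X i j = (\<Sum>k<?M. madd S T i k * X k j)"
    by (rule mmult_banded_left[OF assms(1)] mmult_banded_left[OF assms(2)] mmult_banded_left[OF banded_add[OF assms]]; simp)+
  then show "mmult (madd S T) X i j = madd (mmult S X) (mmult T X) i j"
    by (simp add: madd_def sum.distrib algebra_simps del: sum.lessThan_Suc)
qed

lemma mmult_smult_right: "banded B S \<Longrightarrow> mmult X (msmult c S) = msmult c (mmult X S)"
proof (intro ext)
  fix i j assume "banded B S"
  then show "mmult X (msmult c S) i j = msmult c (mmult X S) i j"
    using mmult_banded_right[of B S j "Suc (j + B)" X i]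
      mmult_banded_right[OF banded_smult, of B S j "Suc (j + B)" X c i]
    by (simp add: msmult_def sum_distrib_left algebra_simps)
qed

lemma mmult_smult_left: "banded B S \<Longrightarrow> mmult (msmult c S) X = msmult c (mmult S X)"
proof (intro ext)
  fix i j assume "banded B S"
  then show "mmult (msmult c S) X i j = msmult c (mmult S X) i j"
    using mmult_banded_left[of B S i "Suc (i + B)" X j]
      mmult_banded_left[OF banded_smult, of B S i "Suc (i + B)" c X j]
    by (simp add: msmult_def sum_distrib_left algebra_simps)
qed

lemma banded_mmult_msub:
  assumes "banded B S"
  shows "mmult S (msub P Q) = msub (mmult S P) (mmult S Q)"
proof (intro ext)
  fix i j
  show "mmult S (msub P Q) i j = msub (mmult S P) (mmult S Q) i j"
    using mmult_banded_left[OF assms, of i "Suc (i + B)" _ j]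
    by (simp add: msub_def sum_subtractf algebra_simps)
qed

lemma msub_mmult_banded:
  assumes "banded B S"
  shows "mmult (msub P Q) S = msub (mmult P S) (mmult Q S)"
proof (intro ext)
  fix i j
  show "mmult (msub P Q) S i j = msub (mmult P S) (mmult Q S) i j"
    using mmult_banded_right[OF assms, of j "Suc (j + B)" _ i]
    by (simp add: msub_def sum_subtractf algebra_simps)
qed

text \<open>Products of infinite matrices need not associate. With two band factors all sums are
  finite and can be interchanged, wherever the arbitrary, possibly unbounded \<open>X\<close>
  stands; this and the next two lemmas treat the three positions occurring in the Leibniz
  rule.\<close>

lemma mmult_assoc_mid:
  assumes "banded B S" "banded C T"
  shows "mmult (mmult S X) T = mmult S (mmult X T)"
proof (intro ext)
  fix i j
  let ?M = "Suc (i + B)" and ?N = "Suc (j + C)"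
  have "mmult (mmult S X) T i j = (\<Sum>l<?N. \<Sum>k<?M. S i k * X k l * T l j)"
    by (simp add: mmult_banded_right[OF assms(2), where M = ?N] mmult_banded_left[OF assms(1), where M = ?M]
        sum_distrib_right del: sum.lessThan_Suc)
  also have "\<dots> = (\<Sum>k<?M. \<Sum>l<?N. S i k * X k l * T l j)"
    by (rule sum.swap)
  also have "\<dots> = mmult S (mmult X T) i j"
    by (simp add: mmult_banded_right[OF assms(2), where M = ?N] mmult_banded_left[OF assms(1), where M = ?M]
        sum_distrib_left mult.assoc del: sum.lessThan_Suc)
  finally show "mmult (mmult S X) T i j = mmult S (mmult X T) i j" .
qed

lemma mmult_assoc_right:
  assumes "banded B S" "banded C T"
  shows "mmult (mmult X S) T = mmult X (mmult S T)"
proof (intro ext)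
  fix i j
  let ?N = "Suc (j + C)" and ?M = "Suc (j + (B + C))"
  have "mmult (mmult X S) T i j = (\<Sum>l<?N. mmult X S i l * T l j)"
    by (simp add: mmult_banded_right[OF assms(2), where M = ?N] del: sum.lessThan_Suc)
  also have "\<dots> = (\<Sum>l<?N. \<Sum>k<?M. X i k * S k l * T l j)"
    by (intro sum.cong refl) (simp add: mmult_banded_right[OF assms(1), where M = ?M] sum_distrib_right del: sum.lessThan_Suc)
  also have "\<dots> = (\<Sum>k<?M. \<Sum>l<?N. X i k * S k l * T l j)"
    by (rule sum.swap)
  also have "\<dots> = (\<Sum>k<?M. X i k * mmult S T k j)"
    by (simp add: mmult_banded_right[OF assms(2), where M = ?N] sum_distrib_left mult.assoc del: sum.lessThan_Suc)
  also have "\<dots> = mmult X (mmult S T) i j"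
    using mmult_banded_right[OF banded_mult[OF assms], of j ?M X i] by simp
  finally show "mmult (mmult X S) T i j = mmult X (mmult S T) i j" .
qed

lemma mmult_assoc_left:
  assumes "banded B S" "banded C T"
  shows "mmult (mmult S T) X = mmult S (mmult T X)"
proof (intro ext)
  fix i j
  let ?N = "Suc (i + B)" and ?M = "Suc (i + (B + C))"
  have "mmult S (mmult T X) i j = (\<Sum>k<?N. S i k * mmult T X k j)"
    by (simp add: mmult_banded_left[OF assms(1), where M = ?N] del: sum.lessThan_Suc)
  also have "\<dots> = (\<Sum>k<?N. \<Sum>l<?M. S i k * T k l * X l j)"
    by (intro sum.cong refl) (simp add: mmult_banded_left[OF assms(2), where M = ?M] sum_distrib_left mult.assoc del: sum.lessThan_Suc)
  also have "\<dots> = (\<Sum>l<?M. \<Sum>k<?N. S i k * T k l * X l j)"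
    by (rule sum.swap)
  also have "\<dots> = (\<Sum>l<?M. mmult S T i l * X l j)"
    by (simp add: mmult_banded_left[OF assms(1), where M = ?N] sum_distrib_right mult.assoc del: sum.lessThan_Suc)
  also have "\<dots> = mmult (mmult S T) X i j"
    using mmult_banded_left[OF banded_mult[OF assms], of i ?M X j] by simp
  finally show "mmult (mmult S T) X i j = mmult S (mmult T X) i j" by simp
qed

lemma mcomm_mult:
  assumes "banded B a" "banded C b"
  shows "mcomm Z (mmult a b) = madd (mmult a (mcomm Z b)) (mmult (mcomm Z a) b)"
  unfolding mcomm_def banded_mmult_msub[OF assms(1)] msub_mmult_banded[OF assms(2)]
    mmult_assoc_mid[OF assms] mmult_assoc_right[OF assms] mmult_assoc_left[OF assms]
  by (simp add: msub_def madd_def)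

lemma mcomm_add:
  assumes "banded B a" "banded C b"
  shows "mcomm Z (madd a b) = madd (mcomm Z a) (mcomm Z b)"
  unfolding mcomm_def mmult_add_left[OF assms] mmult_add_right[OF assms]
  by (auto simp: msub_def madd_def fun_eq_iff)

lemma mcomm_smult:
  assumes "banded B a"
  shows "mcomm Z (msmult c a) = msmult c (mcomm Z a)"
  unfolding mcomm_def mmult_smult_left[OF assms] mmult_smult_right[OF assms]
  by (auto simp: msub_def msmult_def algebra_simps)

lemma mcomm_msub_left:
  assumes "banded B a"
  shows "mcomm (msub Z Y) a = msub (mcomm Z a) (mcomm Y a)"
  unfolding mcomm_def banded_mmult_msub[OF assms] msub_mmult_banded[OF assms]
  by (auto simp: msub_def fun_eq_iff)

text \<open>Indexed by naturals rather than by points of the orbit, so that unbounded diagonals such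
  as the number operator in \<open>Kcomm_conv\<close> are included.\<close>

definition mdiag :: "(nat \<Rightarrow> complex) \<Rightarrow> mat" where
  "mdiag f = (\<lambda>i j. if i = j then f i else 0)"

lemma mmult_mdiag_left [simp]: "mmult (mdiag f) T i j = f i * T i j"
  using mmult_left[of "{i}" "mdiag f" i T j] by (simp add: mdiag_def)

lemma mmult_mdiag_right [simp]: "mmult T (mdiag f) i j = T i j * f j"
  using mmult_right[of "{j}" "mdiag f" j T i] by (simp add: mdiag_def)

lemma Mdiag_conv: "Mdiag x1 f = mdiag (\<lambda>i. f (natmul i x1))"
  by (simp add: Mdiag_def mdiag_def)

lemma Kcomm_conv: "Kcomm a = mcomm (mdiag of_nat) a"
  by (auto simp: Kcomm_def mcomm_def msub_def algebra_simps)

lemma madj_mdiag: "madj (mdiag f) = mdiag (\<lambda>i. cnj (f i))"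
  by (auto simp: madj_def mdiag_def fun_eq_iff)

lemma banded_mdiag: "banded 0 (mdiag f)"
  by (auto simp: banded_def mdiag_def)

lemma banded_shiftU: "banded 1 shiftU"
  by (auto simp: banded_def shiftU_def)

section \<open>The operator algebras\<close>

lemma mmult_shiftU_left: "mmult shiftU T i j = (case i of 0 \<Rightarrow> 0 | Suc k \<Rightarrow> T k j)"
proof (cases i)
  case 0
  then show ?thesis using mmult_left[of "{}" shiftU i T j] by (simp add: shiftU_def)
next
  case (Suc k)
  then show ?thesis using mmult_left[of "{k}" shiftU i T j] by (simp add: shiftU_def)
qed

lemma mmult_shiftU_right: "mmult T shiftU i j = T i (Suc j)"
  using mmult_right[of "{Suc j}" shiftU j T i] by (simp add: shiftU_def)

lemma mmult_Ustar_left: "mmult (madj shiftU) T i j = T (Suc i) j"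
  using mmult_left[of "{Suc i}" "madj shiftU" i T j] by (simp add: shiftU_def madj_def)

lemma mmult_Ustar_right: "mmult T (madj shiftU) i j = (case j of 0 \<Rightarrow> 0 | Suc k \<Rightarrow> T i k)"
proof (cases j)
  case 0
  then show ?thesis using mmult_right[of "{}" "madj shiftU" j T i] by (simp add: shiftU_def madj_def)
next
  case (Suc k)
  then show ?thesis using mmult_right[of "{k}" "madj shiftU" j T i] by (simp add: shiftU_def madj_def)
qed

lemma calA_subset_starAlgC: "a \<in> calA x1 \<Longrightarrow> a \<in> starAlgC x1"
  by (induction rule: calA.induct) (auto intro: starAlgC.intros simp: character_def)

lemma starAlgC_banded: "a \<in> starAlgC x1 \<Longrightarrow> \<exists>B. banded B a"
proof (induction rule: starAlgC.induct)
  case (gen_f f) then show ?case unfolding Mdiag_conv using banded_mdiag by blast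
qed (blast intro: banded_shiftU banded_add banded_smult banded_mult banded_adj)+

lemma starAlgC_bounded:
  fixes x1 :: "'g::topological_ab_group_add"
  assumes comp: "compact (UNIV :: 'g set)" and a: "a \<in> starAlgC x1"
  shows "\<exists>C. op_bound C a"
  using a
proof (induction rule: starAlgC.induct)
  case gen_U
  have "op_bound (real (2 * 1 + 1) * 1) shiftU"
    by (intro banded_op_bound banded_shiftU) (auto simp: shiftU_def)
  then show ?case by blast
next
  case (gen_f f)
  obtain C where C: "\<And>x. cmod (f x) \<le> C" using continuous_bounded[OF comp gen_f] by blast
  have "op_bound (real (2 * 0 + 1) * C) (Mdiag x1 f)"
    unfolding Mdiag_conv using C order_trans[OF norm_ge_zero C]
    by (intro banded_op_bound banded_mdiag) (auto simp: mdiag_def)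
  then show ?case by blast
next
  case (mult a b)
  then show ?case using op_bound_mult_right starAlgC_banded by blast
qed (blast intro: op_bound_add op_bound_smult op_bound_adj)+

lemma character_one: "character (\<lambda>_. 1)"
  by (simp add: character_def)

lemma character_cnj: "character ch \<Longrightarrow> character (\<lambda>x. cnj (ch x))"
  by (auto simp: character_def intro!: continuous_intros)

lemma one_calA: "mdiag (\<lambda>_. 1) \<in> calA x1"
  using calA.gen_chi[OF character_one, of x1] by (simp add: Mdiag_conv)

definition munit :: "nat \<Rightarrow> nat \<Rightarrow> mat" where
  "munit k l = (\<lambda>i j. if i = k \<and> j = l then 1 else 0)"

text \<open>\<open>1 - U U*\<close> is the projection onto the first basis vector; left
  multiplication by \<open>U\<close> then moves the row index, and right multiplication by
  \<open>U*\<close> the column index.\<close>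

lemma munit_calA: "munit k l \<in> calA x1"
proof (induction k)
  case 0
  show ?case
  proof (induction l)
    case 0
    have "munit 0 0 = madd (mdiag (\<lambda>_. 1)) (msmult (-1) (mmult shiftU (madj shiftU)))"
      by (auto simp: fun_eq_iff munit_def madd_def msmult_def mdiag_def mmult_shiftU_left split: nat.split)
        (auto simp: madj_def shiftU_def)
    also have "\<dots> \<in> calA x1"
      by (intro calA.intros one_calA)
    finally show ?case .
  next
    case (Suc l)
    have "munit 0 (Suc l) = mmult (munit 0 l) (madj shiftU)"
      by (auto simp: fun_eq_iff munit_def mmult_Ustar_right split: nat.split)
    with Suc show ?case by (metis calA.mult calA.gen_Ustar)
  qed
next
  case (Suc k)
  have "munit (Suc k) l = mmult shiftU (munit k l)"
    by (auto simp: fun_eq_iff munit_def mmult_shiftU_left split: nat.split)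
  with Suc show ?case by (metis calA.mult calA.gen_U)
qed

lemma starAlgC_zero: "(\<lambda>i j. 0) \<in> starAlgC x1"
  using starAlgC.smult[OF starAlgC.gen_U, of 0 x1] by (simp add: msmult_def)

lemma starAlgC_sum:
  assumes "finite K" "\<And>k. k \<in> K \<Longrightarrow> M k \<in> starAlgC x1"
  shows "(\<lambda>i j. \<Sum>k\<in>K. M k i j) \<in> starAlgC x1"
  using assms
proof (induction K rule: finite_induct)
  case (insert k K)
  then have "madd (M k) (\<lambda>i j. \<Sum>k\<in>K. M k i j) \<in> starAlgC x1"
    by (intro starAlgC.add) auto
  with insert show ?case by (simp add: madd_def)
qed (simp add: starAlgC_zero)

section \<open>The grading by diagonals\<close>

definition dpart :: "int \<Rightarrow> mat \<Rightarrow> mat" where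
  "dpart n T = (\<lambda>i j. if int i - int j = n then T i j else 0)"

text \<open>\<open>dpart n\<close> is the component of degree \<open>n\<close> in the grading where
  \<open>shiftU\<close> has degree 1, and degrees add under products. The factor \<open>S\<close>
  has degrees only in \<open>{-int B..int B}\<close>, which makes the sum finite.\<close>

lemma dpart_mult:
  assumes "banded B S" "banded C T"
  shows "dpart n (mmult S T) = (\<lambda>i j. \<Sum>k\<in>{-int B..int B}. mmult (dpart k S) (dpart (n - k) T) i j)"
proof (intro ext)
  fix i j
  let ?M = "Suc (i + B)"
  have b: "banded B (dpart k S)" for k
    using assms(1) by (auto simp: banded_def dpart_def)
  have "(\<Sum>k\<in>{-int B..int B}. mmult (dpart k S) (dpart (n - k) T) i j) =
      (\<Sum>k\<in>{-int B..int B}. \<Sum>l<?M. dpart k S i l * dpart (n - k) T l j)"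
    by (simp add: mmult_banded_left[OF b, where M = ?M] del: sum.lessThan_Suc)
  also have "\<dots> = (\<Sum>l<?M. \<Sum>k\<in>{-int B..int B}. dpart k S i l * dpart (n - k) T l j)"
    by (rule sum.swap)
  also have "\<dots> = (\<Sum>l<?M. if int i - int j = n then S i l * T l j else 0)"
  proof (intro sum.cong refl)
    fix l
    \<comment> \<open>Only the degree \<open>k = int i - int l\<close> meets the summand
      \<open>l\<close>.\<close>
    have "(\<Sum>k\<in>{-int B..int B}. dpart k S i l * dpart (n - k) T l j) =
        (\<Sum>k\<in>{-int B..int B}. if k = int i - int l then (if int i - int j = n then S i l * T l j else 0) else 0)"
      by (intro sum.cong refl) (auto simp: dpart_def)
    also have "\<dots> = (if int i - int j = n then S i l * T l j else 0)"
    proof (cases "S i l = 0")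
      case False
      then have "i \<le> l + B \<and> l \<le> i + B" using assms(1) by (auto simp: banded_def)
      then have "int i - int l \<in> {-int B..int B}" by auto
      then show ?thesis by simp
    qed (auto intro: sum.neutral)
    finally show "(\<Sum>k\<in>{-int B..int B}. dpart k S i l * dpart (n - k) T l j) =
        (if int i - int j = n then S i l * T l j else 0)" .
  qed
  also have "\<dots> = dpart n (mmult S T) i j"
    by (simp add: dpart_def mmult_banded_left[OF assms(1), where M = ?M] del: sum.lessThan_Suc)
  finally show "dpart n (mmult S T) i j = (\<Sum>k\<in>{-int B..int B}. mmult (dpart k S) (dpart (n - k) T) i j)"
    by simp
qed

text \<open>All generators are homogeneous, and \<open>dpart\<close> passes through the algebra
  operations, with \<open>n\<close> becoming \<open>- n\<close> under adjoints.\<close>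

lemma starAlgC_dpart: "a \<in> starAlgC x1 \<Longrightarrow> dpart n a \<in> starAlgC x1"
proof (induction arbitrary: n rule: starAlgC.induct)
  case gen_U
  have "dpart n shiftU = (if n = 1 then shiftU else (\<lambda>i j. 0))"
    by (auto simp: dpart_def shiftU_def fun_eq_iff)
  then show ?case by (simp add: starAlgC.gen_U starAlgC_zero)
next
  case (gen_f f)
  have "dpart n (Mdiag x1 f) = (if n = 0 then Mdiag x1 f else (\<lambda>i j. 0))"
    by (auto simp: dpart_def Mdiag_def fun_eq_iff)
  with gen_f show ?case by (simp add: starAlgC.gen_f starAlgC_zero)
next
  case (add a b)
  have "dpart n (madd a b) = madd (dpart n a) (dpart n b)"
    by (auto simp: dpart_def madd_def fun_eq_iff)
  with add show ?case by (simp add: starAlgC.add)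
next
  case (smult a c)
  have "dpart n (msmult c a) = msmult c (dpart n a)"
    by (auto simp: dpart_def msmult_def fun_eq_iff)
  with smult show ?case by (simp add: starAlgC.smult)
next
  case (mult a b)
  obtain B where B: "banded B a" using starAlgC_banded[OF mult.hyps(1)] ..
  obtain C where C: "banded C b" using starAlgC_banded[OF mult.hyps(2)] ..
  show ?case
    unfolding dpart_mult[OF B C] by (intro starAlgC_sum starAlgC.mult mult.IH) simp
next
  case (adj a)
  have "dpart n (madj a) = madj (dpart (-n) a)"
    by (auto simp: dpart_def madj_def fun_eq_iff)
  with adj show ?case by (simp add: starAlgC.adj)
qed

lemma op_bound_dpart:
  assumes "op_bound C T"
  shows "op_bound C (dpart n T)"
  by (rule op_bound_homogeneous[of _ n])
    (use op_bound_entry[OF assms] op_bound_nonneg[OF assms] in \<open>auto simp: dpart_def split: if_splits\<close>)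

text \<open>Trades the supremum \<open>opnorm\<close> for \<open>op_bound\<close>; boundedness of
  \<open>T\<close> is inherited from a bounded approximant. Passing to \<open>e/2\<close> restores
  the strict inequality of \<open>algA_def\<close>.\<close>

lemma algA_iff:
  fixes x1 :: "'g::topological_ab_group_add"
  assumes comp: "compact (UNIV :: 'g set)"
  shows "T \<in> algA x1 \<longleftrightarrow> (\<forall>e>0. \<exists>S\<in>starAlgC x1. op_bound e (msub T S))"
proof
  assume T: "T \<in> algA x1"
  show "\<forall>e>0. \<exists>S\<in>starAlgC x1. op_bound e (msub T S)"
  proof (intro allI impI)
    fix e :: real assume "e > 0"
    then obtain S where S: "S \<in> starAlgC x1" "opnorm (msub T S) < e"
      using T unfolding algA_def by blast
    obtain C where "op_bound C S" using starAlgC_bounded[OF comp S(1)] ..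
    moreover obtain D where "op_bound D T" using T unfolding algA_def bounded_op_iff by blast
    ultimately have "bounded_op (msub T S)"
      using op_bound_sub op_bound_imp_opnorm_le(1) by blast
    then have "op_bound e (msub T S)"
      using S(2) by (intro op_bound_mono[OF bounded_op_imp_op_bound]) auto
    with S(1) show "\<exists>S\<in>starAlgC x1. op_bound e (msub T S)" by blast
  qed
next
  assume T: "\<forall>e>0. \<exists>S\<in>starAlgC x1. op_bound e (msub T S)"
  obtain S where S: "S \<in> starAlgC x1" "op_bound 1 (msub T S)"
    using T by (meson zero_less_one)
  obtain C where "op_bound C S" using starAlgC_bounded[OF comp S(1)] ..
  then have "op_bound (1 + C) (madd (msub T S) S)"
    using S(2) by (intro op_bound_add)
  then have "bounded_op T"
    unfolding bounded_op_iff by (auto simp: madd_def msub_def)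
  moreover have "\<exists>S\<in>starAlgC x1. opnorm (msub T S) < e" if "e > 0" for e
  proof -
    from that have "e/2 > 0" by simp
    then obtain S where S: "S \<in> starAlgC x1" "op_bound (e/2) (msub T S)"
      using T by blast
    have "opnorm (msub T S) < e"
      using op_bound_imp_opnorm_le(2)[OF S(2)] that by simp
    with S(1) show ?thesis by blast
  qed
  ultimately show "T \<in> algA x1" unfolding algA_def by blast
qed

lemma op_bound_zero: "op_bound 0 (\<lambda>i j. 0)"
  by (simp add: op_bound_def)

lemma op_bound_msub_self: "0 \<le> e \<Longrightarrow> op_bound e (msub T T)"
  using op_bound_mono[OF op_bound_zero] by (simp add: msub_def)

section \<open>Closure properties of \<open>algA\<close> and its diagonal operators\<close>

context
  fixes x1 :: "'g::topological_ab_group_add"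
  assumes comp: "compact (UNIV :: 'g set)"
begin

lemma starAlgC_subset_algA: "T \<in> starAlgC x1 \<Longrightarrow> T \<in> algA x1"
  unfolding algA_iff[OF comp] by (auto intro!: bexI[of _ T] op_bound_msub_self)

lemma algA_add:
  assumes "S \<in> algA x1" "T \<in> algA x1"
  shows "madd S T \<in> algA x1"
  unfolding algA_iff[OF comp]
proof (intro allI impI)
  fix e :: real assume "e > 0"
  then have "e/2 > 0" by simp
  then obtain S' T' where S': "S' \<in> starAlgC x1" "op_bound (e/2) (msub S S')"
    and T': "T' \<in> starAlgC x1" "op_bound (e/2) (msub T T')"
    using assms unfolding algA_iff[OF comp] by blast
  have "op_bound (e/2 + e/2) (madd (msub S S') (msub T T'))"
    by (intro op_bound_add S' T')
  then have "op_bound e (msub (madd S T) (madd S' T'))"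
    by (simp add: madd_def msub_def algebra_simps)
  then show "\<exists>R\<in>starAlgC x1. op_bound e (msub (madd S T) R)"
    using S' T' starAlgC.add by blast
qed

lemma algA_mult_right:
  assumes T: "T \<in> algA x1" and S: "S \<in> starAlgC x1"
  shows "mmult T S \<in> algA x1"
  unfolding algA_iff[OF comp]
proof (intro allI impI)
  fix e :: real assume e: "e > 0"
  obtain C where C: "op_bound C S" using starAlgC_bounded[OF comp S] ..
  obtain B where B: "banded B S" using starAlgC_banded[OF S] ..
  have C0: "0 \<le> C" by (rule op_bound_nonneg[OF C])
  \<comment> \<open>The summand 1 keeps the divisor positive when \<open>C = 0\<close>.\<close>
  define e' where "e' = e / (C + 1)"
  have "e' > 0" using e C0 by (simp add: e'_def)
  then obtain R where R: "R \<in> starAlgC x1" "op_bound e' (msub T R)"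
    using T unfolding algA_iff[OF comp] by blast
  have "op_bound (e' * C) (mmult (msub T R) S)"
    by (rule op_bound_mult_right[OF R(2) C B])
  moreover have "e' * C \<le> e"
    using e C0 by (simp add: e'_def field_simps)
  ultimately have "op_bound e (msub (mmult T S) (mmult R S))"
    unfolding msub_mmult_banded[OF B] by (rule op_bound_mono)
  then show "\<exists>R\<in>starAlgC x1. op_bound e (msub (mmult T S) R)"
    using R S starAlgC.mult by blast
qed

lemma algA_mult_left:
  assumes T: "T \<in> algA x1" and S: "S \<in> starAlgC x1"
  shows "mmult S T \<in> algA x1"
  unfolding algA_iff[OF comp]
proof (intro allI impI)
  fix e :: real assume e: "e > 0"
  obtain C where C: "op_bound C S" using starAlgC_bounded[OF comp S] ..
  obtain B where B: "banded B S" using starAlgC_banded[OF S] ..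
  have C0: "0 \<le> C" by (rule op_bound_nonneg[OF C])
  define e' where "e' = e / (C + 1)"
  have "e' > 0" using e C0 by (simp add: e'_def)
  then obtain R where R: "R \<in> starAlgC x1" "op_bound e' (msub T R)"
    using T unfolding algA_iff[OF comp] by blast
  have "op_bound (e' * C) (mmult S (msub T R))"
    by (rule op_bound_mult_left[OF R(2) C B])
  moreover have "e' * C \<le> e"
    using e C0 by (simp add: e'_def field_simps)
  ultimately have "op_bound e (msub (mmult S T) (mmult S R))"
    unfolding banded_mmult_msub[OF B] by (rule op_bound_mono)
  then show "\<exists>R\<in>starAlgC x1. op_bound e (msub (mmult S T) R)"
    using R S starAlgC.mult by blast
qed

lemma mconst_starAlgC: "mdiag (\<lambda>_. c) \<in> starAlgC x1"
  using starAlgC.gen_f[of "\<lambda>_. c" x1] by (simp add: Mdiag_conv)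

lemma algA_smult:
  assumes T: "T \<in> algA x1"
  shows "msmult c T \<in> algA x1"
proof -
  have "msmult c T = mmult (mdiag (\<lambda>_. c)) T"
    by (simp add: fun_eq_iff msmult_def)
  then show ?thesis
    using algA_mult_left[OF T mconst_starAlgC] by simp
qed

lemma algA_sum:
  assumes "finite K" "\<And>k. k \<in> K \<Longrightarrow> M k \<in> algA x1"
  shows "(\<lambda>i j. \<Sum>k\<in>K. M k i j) \<in> algA x1"
  using assms
proof (induction K rule: finite_induct)
  case (insert k K)
  then have "madd (M k) (\<lambda>i j. \<Sum>k\<in>K. M k i j) \<in> algA x1"
    by (intro algA_add) auto
  with insert show ?case by (simp add: madd_def)
qed (simp add: starAlgC_subset_algA starAlgC_zero)

lemma algA_dpart:
  assumes T: "T \<in> algA x1"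
  shows "dpart n T \<in> algA x1"
  unfolding algA_iff[OF comp]
proof (intro allI impI)
  fix e :: real assume e: "e > 0"
  then obtain R where R: "R \<in> starAlgC x1" "op_bound e (msub T R)"
    using T unfolding algA_iff[OF comp] by blast
  have "msub (dpart n T) (dpart n R) = dpart n (msub T R)"
    by (auto simp: dpart_def msub_def fun_eq_iff)
  with op_bound_dpart[OF R(2), of n] have "op_bound e (msub (dpart n T) (dpart n R))" by simp
  then show "\<exists>S\<in>starAlgC x1. op_bound e (msub (dpart n T) S)"
    using starAlgC_dpart[OF R(1)] by blast
qed

text \<open>Compressing a diagonal operator by the shift, \<open>U* D U\<close>, moves its sequence
  by one place.\<close>

lemma algA_mdiag_shift:
  assumes "mdiag f \<in> algA x1"
  shows "mdiag (\<lambda>k. f (k + l)) \<in> algA x1"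
proof (induction l)
  case (Suc l)
  have "mdiag (\<lambda>k. f (k + Suc l)) = mmult (madj shiftU) (mmult (mdiag (\<lambda>k. f (k + l))) shiftU)"
    by (auto simp: fun_eq_iff mmult_Ustar_left mmult_shiftU_right) (auto simp: mdiag_def shiftU_def)
  with Suc show ?case
    by (simp add: algA_mult_left algA_mult_right starAlgC.gen_U starAlgC.adj)
qed (use assms in simp)

lemma algA_mdiag_sum:
  assumes "finite K" "\<And>k. k \<in> K \<Longrightarrow> mdiag (f k) \<in> algA x1"
  shows "mdiag (\<lambda>i. \<Sum>k\<in>K. f k i) \<in> algA x1"
proof -
  have "mdiag (\<lambda>i. \<Sum>k\<in>K. f k i) = (\<lambda>i j. \<Sum>k\<in>K. mdiag (f k) i j)"
    by (auto simp: fun_eq_iff mdiag_def)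
  with algA_sum[OF assms] show ?thesis by simp
qed

lemma algA_mdiag_scale: "mdiag f \<in> algA x1 \<Longrightarrow> mdiag (\<lambda>i. c * f i) \<in> algA x1"
  using algA_smult[of "mdiag f" c] by (simp add: msmult_def mdiag_def if_distrib cong: if_cong)

lemma algA_mdiag_add: "mdiag f \<in> algA x1 \<Longrightarrow> mdiag g \<in> algA x1 \<Longrightarrow> mdiag (\<lambda>i. f i + g i) \<in> algA x1"
proof -
  assume "mdiag f \<in> algA x1" "mdiag g \<in> algA x1"
  then have "madd (mdiag f) (mdiag g) \<in> algA x1" by (rule algA_add)
  moreover have "madd (mdiag f) (mdiag g) = mdiag (\<lambda>i. f i + g i)"
    by (auto simp: fun_eq_iff mdiag_def madd_def)
  ultimately show ?thesis by simp
qed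

text \<open>A scalar operator plus finitely many multiples of diagonal matrix units.\<close>

lemma algA_mdiag_eventually_const:
  assumes "\<And>k. k \<ge> k0 \<Longrightarrow> f k = c"
  shows "mdiag f \<in> algA x1"
proof -
  have "munit k k \<in> algA x1" for k
    using munit_calA calA_subset_starAlgC starAlgC_subset_algA by blast
  then have "(\<lambda>i j. \<Sum>k<k0. msmult (f k - c) (munit k k) i j) \<in> algA x1"
    by (intro algA_sum algA_smult) auto
  then have "madd (mdiag (\<lambda>_. c)) (\<lambda>i j. \<Sum>k<k0. msmult (f k - c) (munit k k) i j) \<in> algA x1"
    by (intro algA_add starAlgC_subset_algA[OF mconst_starAlgC])
  moreover have "madd (mdiag (\<lambda>_. c)) (\<lambda>i j. \<Sum>k<k0. msmult (f k - c) (munit k k) i j) = mdiag f"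
  proof (intro ext)
    fix i j
    have "(\<Sum>k<k0. msmult (f k - c) (munit k k) i j) = (\<Sum>k<k0. if k = i then (if i = j then f i - c else 0) else 0)"
      by (intro sum.cong) (auto simp: msmult_def munit_def)
    also have "\<dots> = (if i = j then f i - c else 0)"
      using assms[of i] by (auto simp: not_less)
    finally show "madd (mdiag (\<lambda>_. c)) (\<lambda>i j. \<Sum>k<k0. msmult (f k - c) (munit k k) i j) i j = mdiag f i j"
      by (simp add: madd_def mdiag_def)
  qed
  ultimately show ?thesis by simp
qed

text \<open>The discrete cohomological equation: \<open>\<alpha>\<close> minus its moving mean
  \<open>A\<close> over \<open>N\<close> terms is exactly the coboundary of \<open>\<beta>1\<close>,
  a finite combination of shifts of \<open>\<alpha>\<close> and hence in \<open>algA\<close>. What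
  remains, \<open>A - c\<close>, is small from \<open>k0\<close> on.\<close>

lemma approximate_coboundary:
  assumes \<alpha>: "mdiag \<alpha> \<in> algA x1" and e: "0 \<le> e" and N: "0 < N"
    and mean: "\<And>k. k \<ge> k0 \<Longrightarrow> cmod ((\<Sum>l<N. \<alpha> (k + l)) / of_nat N - c) \<le> e"
  obtains \<beta> where "mdiag \<beta> \<in> algA x1" "\<And>k. cmod (\<alpha> k - c - (\<beta> (Suc k) - \<beta> k)) \<le> e"
proof -
  define A where "A k = (\<Sum>l<N. \<alpha> (k + l)) / of_nat N" for k
  \<comment> \<open>Under \<open>k \<mapsto> Suc k\<close> the inner sum changes by
    \<open>\<alpha> (k + i) - \<alpha> k\<close>, so averaging over \<open>i\<close> gives
    \<open>\<beta>1 (Suc k) - \<beta>1 k = \<alpha> k - A k\<close>.\<close>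
  define \<beta>1 where "\<beta>1 k = (- 1 / of_nat N) * (\<Sum>i<N. \<Sum>l<i. \<alpha> (k + l))" for k
  \<comment> \<open>Below \<open>k0\<close> the means are not controlled; \<open>\<beta>2\<close>
    sums \<open>A - c\<close> there exactly and is constant afterwards, so it stays in
    \<open>algA\<close>.\<close>
  define \<beta>2 where "\<beta>2 k = (\<Sum>l<min k k0. A l - c)" for k
  have "mdiag \<beta>1 \<in> algA x1"
    unfolding \<beta>1_def by (intro algA_mdiag_scale algA_mdiag_sum algA_mdiag_shift[OF \<alpha>]) auto
  moreover have "mdiag \<beta>2 \<in> algA x1"
    by (rule algA_mdiag_eventually_const[of k0 _ "\<beta>2 k0"]) (simp add: \<beta>2_def min_def)
  ultimately have "mdiag (\<lambda>k. \<beta>1 k + \<beta>2 k) \<in> algA x1"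
    by (rule algA_mdiag_add)
  moreover have "cmod (\<alpha> k - c - (\<beta>1 (Suc k) + \<beta>2 (Suc k) - (\<beta>1 k + \<beta>2 k))) \<le> e" for k
  proof -
    have tel: "(\<Sum>l<i. \<alpha> (Suc k + l)) - (\<Sum>l<i. \<alpha> (k + l)) = \<alpha> (k + i) - \<alpha> k" for i
      using sum_lessThan_telescope[of "\<lambda>l. \<alpha> (k + l)" i] by (simp add: sum_subtractf)
    have "\<beta>1 (Suc k) - \<beta>1 k = (- 1 / of_nat N) * (\<Sum>i<N. \<alpha> (k + i) - \<alpha> k)"
      unfolding \<beta>1_def right_diff_distrib[symmetric] sum_subtractf[symmetric, where A = "{..<N}"] tel ..
    also have "\<dots> = \<alpha> k - A k"
      using N by (simp add: A_def sum_subtractf field_simps)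
    finally have 1: "\<beta>1 (Suc k) - \<beta>1 k = \<alpha> k - A k" .
    have 2: "\<beta>2 (Suc k) - \<beta>2 k = (if k < k0 then A k - c else 0)"
      by (auto simp: \<beta>2_def min_def)
    have "\<alpha> k - c - (\<beta>1 (Suc k) + \<beta>2 (Suc k) - (\<beta>1 k + \<beta>2 k)) =
        \<alpha> k - c - (\<beta>1 (Suc k) - \<beta>1 k) - (\<beta>2 (Suc k) - \<beta>2 k)" by simp
    also have "\<dots> = (if k < k0 then 0 else A k - c)"
      unfolding 1 2 by simp
    finally show ?thesis using mean[of k] e by (simp add: A_def)
  qed
  ultimately show ?thesis by (rule that)
qed

end

text \<open>The relation \<open>U U* = 1\<close> fails in a single entry only, so far down the
  diagonals the algebra behaves like a crossed product: a diagonal is a continuous function read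
  along the orbit, and products combine such functions with translations by multiples of
  \<open>x1\<close>.\<close>

lemma starAlgC_asymptotic_diagonal:
  "S \<in> starAlgC x1 \<Longrightarrow> \<exists>f k0. continuous_on UNIV f \<and>
     (\<forall>j\<ge>k0. \<forall>i. int i - int j = n \<longrightarrow> S i j = f (natmul j x1))"
proof (induction arbitrary: n rule: starAlgC.induct)
  case gen_U
  show ?case
    by (intro exI[of _ "\<lambda>_. if n = 1 then 1 else 0"] exI[of _ 0]) (auto simp: shiftU_def)
next
  case (gen_f f)
  have "continuous_on UNIV (\<lambda>x. if n = 0 then f x else 0)"
    using gen_f by (cases "n = 0") auto
  then show ?case
    by (intro exI[of _ "\<lambda>x. if n = 0 then f x else 0"] exI[of _ 0]) (auto simp: Mdiag_def)
next
  case (add a b)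
  obtain f k where f: "continuous_on UNIV f" "\<forall>j\<ge>k. \<forall>i. int i - int j = n \<longrightarrow> a i j = f (natmul j x1)"
    using add.IH(1)[of n] by blast
  obtain g l where g: "continuous_on UNIV g" "\<forall>j\<ge>l. \<forall>i. int i - int j = n \<longrightarrow> b i j = g (natmul j x1)"
    using add.IH(2)[of n] by blast
  show ?case
    by (intro exI[of _ "\<lambda>x. f x + g x"] exI[of _ "max k l"])
      (use f g in \<open>auto simp: madd_def intro!: continuous_intros\<close>)
next
  case (smult a c)
  obtain f k where f: "continuous_on UNIV f" "\<forall>j\<ge>k. \<forall>i. int i - int j = n \<longrightarrow> a i j = f (natmul j x1)"
    using smult.IH[of n] by blast
  show ?case
    by (intro exI[of _ "\<lambda>x. c * f x"] exI[of _ k])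
      (use f in \<open>auto simp: msmult_def intro!: continuous_intros\<close>)
next
  case (mult a b)
  obtain B where B: "banded B a" using starAlgC_banded[OF mult.hyps(1)] ..
  obtain C where C: "banded C b" using starAlgC_banded[OF mult.hyps(2)] ..
  obtain f k where f: "\<And>m. continuous_on UNIV (f m)"
      "\<And>m. \<forall>j\<ge>k m. \<forall>i. int i - int j = m \<longrightarrow> a i j = f m (natmul j x1)"
    using mult.IH(1) by metis
  obtain g l where g: "\<And>m. continuous_on UNIV (g m)"
      "\<And>m. \<forall>j\<ge>l m. \<forall>i. int i - int j = m \<longrightarrow> b i j = g m (natmul j x1)"
    using mult.IH(2) by metis
  let ?I = "{-int C..int C}"
  \<comment> \<open>Past all thresholds for \<open>a\<close> and \<open>b\<close>, plus
    \<open>C\<close>, since the intermediate index \<open>j + m\<close> may lie \<open>C\<close>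
    below \<open>j\<close>.\<close>
  define K where "K = (\<Sum>m\<in>?I. k (n - m) + l m) + C"
  have K: "k (n - m) + C \<le> K" "l m \<le> K" "C \<le> K" if "m \<in> ?I" for m
    unfolding K_def using member_le_sum[OF that, of "\<lambda>m. k (n - m) + l m"] by auto
  show ?case
  proof (intro exI conjI allI impI)
    show "continuous_on UNIV (\<lambda>x. \<Sum>m\<in>?I. f (n - m) (x + zmul m x1) * g m x)"
      by (intro continuous_on_sum continuous_on_mult g continuous_on_compose2[OF f(1)]
          continuous_on_add continuous_on_id continuous_on_const) auto
    fix j i assume j: "K \<le> j" and n: "int i - int j = n"
    have CK: "C \<le> j" using K(3)[of 0] j by simp
    \<comment> \<open>Only intermediate indices \<open>j + m\<close> with \<open>m\<close> in the
      band of \<open>b\<close> contribute; \<open>C \<le> j\<close> keeps \<open>nat\<close> from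
      truncating.\<close>
    have "mmult a b i j = (\<Sum>p\<in>(\<lambda>m. nat (int j + m)) ` ?I. a i p * b p j)"
    proof (rule mmult_right)
      fix p assume p: "p \<notin> (\<lambda>m. nat (int j + m)) ` ?I"
      show "b p j = 0"
      proof (rule ccontr)
        assume "b p j \<noteq> 0"
        then have "p \<le> j + C \<and> j \<le> p + C" using C by (auto simp: banded_def)
        then have "int p - int j \<in> ?I" "p = nat (int j + (int p - int j))" by auto
        with p show False by blast
      qed
    qed simp
    also have "\<dots> = (\<Sum>m\<in>?I. a i (nat (int j + m)) * b (nat (int j + m)) j)"
      using CK by (subst sum.reindex) (auto simp: inj_on_def)
    also have "\<dots> = (\<Sum>m\<in>?I. f (n - m) (natmul j x1 + zmul m x1) * g m (natmul j x1))"
    proof (intro sum.cong refl)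
      fix m assume m: "m \<in> ?I"
      have pos: "0 \<le> int j + m" using m CK by auto
      have "k (n - m) \<le> nat (int j + m)" using K(1)[OF m] j m by auto
      moreover have "int i - int (nat (int j + m)) = n - m" using n pos by simp
      ultimately have "a i (nat (int j + m)) = f (n - m) (natmul (nat (int j + m)) x1)"
        using f(2) by blast
      moreover have "b (nat (int j + m)) j = g m (natmul j x1)"
        using g(2)[of m] K(2)[OF m] j pos by auto
      ultimately show "a i (nat (int j + m)) * b (nat (int j + m)) j =
          f (n - m) (natmul j x1 + zmul m x1) * g m (natmul j x1)"
        by (simp add: natmul_plus_zmul[OF pos])
    qed
    finally show "mmult a b i j = (\<Sum>m\<in>?I. f (n - m) (natmul j x1 + zmul m x1) * g m (natmul j x1))" .
  qed
next
  case (adj a)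
  obtain f k where f: "continuous_on UNIV f" "\<forall>j\<ge>k. \<forall>i. int i - int j = - n \<longrightarrow> a i j = f (natmul j x1)"
    using adj.IH[of "- n"] by blast
  show ?case
  proof (intro exI conjI allI impI)
    show "continuous_on UNIV (\<lambda>x. cnj (f (x + zmul n x1)))"
      by (intro continuous_on_cnj continuous_on_compose2[OF f(1)]
          continuous_on_add continuous_on_id continuous_on_const) auto
    \<comment> \<open>Transposition swaps row and column, so \<open>a\<close> is read at column
      \<open>i = j + n\<close>: hence the translate by \<open>zmul n x1\<close> and the threshold
      raised by \<open>\<bar>n\<bar>\<close>.\<close>
    fix j i assume j: "k + nat \<bar>n\<bar> \<le> j" and n: "int i - int j = n"
    have "k \<le> i" "i = nat (int j + n)" "0 \<le> int j + n" using j n by auto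
    moreover have "int j - int i = - n" using n by simp
    ultimately have "a j i = f (natmul i x1)" using f(2) by blast
    then show "madj a i j = cnj (f (natmul j x1 + zmul n x1))"
      using natmul_plus_zmul[OF \<open>0 \<le> int j + n\<close>, of x1] \<open>i = nat (int j + n)\<close> by (simp add: madj_def)
  qed
qed

section \<open>Ergodic means along the first subdiagonal\<close>

lemma mean_diff_le:
  fixes h :: "nat \<Rightarrow> complex"
  assumes "0 < N" "\<And>n. cmod (h n - c) \<le> e"
  shows "cmod ((\<Sum>n<N. h n) / of_nat N - c) \<le> e"
proof -
  have "(\<Sum>n<N. h n) / of_nat N - c = (\<Sum>n<N. h n - c) / of_nat N"
    using assms(1) by (simp add: sum_subtractf diff_divide_distrib)
  moreover have "0 \<le> e" using assms(2)[of 0] norm_ge_zero order_trans by blast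
  ultimately show ?thesis using norm_mean_le[of "\<lambda>n. h n - c" e N] assms(2) by simp
qed

text \<open>Averaging over both windows at once gives a double mean \<open>?D\<close>, which is a
  mean of means of length \<open>N\<close> as well as of length \<open>N'\<close>; so it is close to
  both \<open>c\<close> and \<open>c'\<close>.\<close>

lemma mean_limits_agree:
  fixes \<alpha> :: "nat \<Rightarrow> complex"
  assumes N: "0 < N" "\<And>k. k \<ge> K \<Longrightarrow> cmod ((\<Sum>l<N. \<alpha> (k + l)) / of_nat N - c) \<le> e"
    and N': "0 < N'" "\<And>k. k \<ge> K' \<Longrightarrow> cmod ((\<Sum>l<N'. \<alpha> (k + l)) / of_nat N' - c') \<le> e'"
  shows "cmod (c - c') \<le> e + e'"
proof -
  let ?k = "max K K'"
  let ?D = "(\<Sum>m<N'. \<Sum>l<N. \<alpha> (?k + m + l)) / of_nat N / of_nat N'"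
  have "cmod ((\<Sum>m<N'. (\<Sum>l<N. \<alpha> (?k + m + l)) / of_nat N) / of_nat N' - c) \<le> e"
    by (intro mean_diff_le N N') auto
  then have 1: "cmod (?D - c) \<le> e" by (simp add: sum_divide_distrib)
  have "cmod ((\<Sum>l<N. (\<Sum>m<N'. \<alpha> (?k + l + m)) / of_nat N') / of_nat N - c') \<le> e'"
    by (intro mean_diff_le N N') auto
  moreover have "(\<Sum>l<N. (\<Sum>m<N'. \<alpha> (?k + l + m)) / of_nat N') / of_nat N = ?D"
  proof -
    have "(\<Sum>m<N'. \<Sum>l<N. \<alpha> (?k + m + l)) = (\<Sum>l<N. \<Sum>m<N'. \<alpha> (?k + l + m))"
      by (subst sum.swap) (simp add: add.commute add.left_commute)
    then show ?thesis by (simp add: sum_divide_distrib[symmetric])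
  qed
  ultimately have 2: "cmod (?D - c') \<le> e'" by simp
  have "cmod (c - c') = cmod ((?D - c') - (?D - c))" by simp
  also have "\<dots> \<le> cmod (?D - c') + cmod (?D - c)" by (rule norm_triangle_ineq4)
  finally show ?thesis using 1 2 by linarith
qed

text \<open>For an approximant in \<open>starAlgC\<close> the diagonal is eventually a continuous
  function on the orbit, and \<open>uniform_mean\<close> applies. The resulting constant depends on
  the approximant, but for finer and finer precision these constants form a Cauchy sequence by
  \<open>mean_limits_agree\<close>.\<close>

lemma (in monothetic) algA_diagonal_mean:
  assumes T: "T \<in> algA x1"
  obtains c where "\<And>e. e > 0 \<Longrightarrow> \<exists>N>0. \<exists>k0. \<forall>k\<ge>k0.
    cmod ((\<Sum>l<N. T (Suc (k + l)) (k + l)) / of_nat N - c) \<le> e"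
proof -
  let ?P = "\<lambda>e c N k0. 0 < N \<and> (\<forall>k\<ge>k0. cmod ((\<Sum>l<N. T (Suc (k + l)) (k + l)) / of_nat N - c) \<le> e)"
  have ex: "\<exists>c N k0. ?P e c N k0" if e: "e > 0" for e
  proof -
    from e have e2: "e/2 > 0" by simp
    then obtain S where S: "S \<in> starAlgC x1" "op_bound (e/2) (msub T S)"
      using T unfolding algA_iff[OF compact_group] by blast
    obtain f k0 where f: "continuous_on UNIV f" "\<forall>j\<ge>k0. \<forall>i. int i - int j = 1 \<longrightarrow> S i j = f (natmul j x1)"
      using starAlgC_asymptotic_diagonal[OF S(1), of 1] by blast
    obtain c where c: "\<And>e. e > 0 \<Longrightarrow> \<exists>N>0. \<forall>x. cmod ((\<Sum>n<N. f (x + natmul n x1)) / of_nat N - c) \<le> e"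
      using uniform_mean[OF f(1)] by blast
    obtain N where N: "0 < N" "\<And>x. cmod ((\<Sum>n<N. f (x + natmul n x1)) / of_nat N - c) \<le> e/2"
      using c[OF e2] by blast
    have "cmod ((\<Sum>l<N. T (Suc (k + l)) (k + l)) / of_nat N - c) \<le> e" if k: "k \<ge> k0" for k
    proof -
      have "(\<Sum>l<N. T (Suc (k + l)) (k + l)) / of_nat N - c =
          (\<Sum>l<N. msub T S (Suc (k + l)) (k + l)) / of_nat N +
          ((\<Sum>l<N. f (natmul k x1 + natmul l x1)) / of_nat N - c)"
      proof -
        have "S (Suc (k + l)) (k + l) = f (natmul k x1 + natmul l x1)" for l
          using f(2)[rule_format, of "k + l" "Suc (k + l)"] k by (simp add: natmul_add)
        then show ?thesis by (simp add: msub_def sum_subtractf diff_divide_distrib)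
      qed
      also have "cmod \<dots> \<le> e/2 + e/2"
        using op_bound_entry[OF S(2)] e2 by (intro norm_triangle_le add_mono norm_mean_le N(2)) auto
      finally show ?thesis by simp
    qed
    with N(1) show ?thesis by blast
  qed
  define r where "r j = inverse (real (Suc j))" for j
  have "\<exists>c N k0. ?P (r j) c N k0" for j by (rule ex) (simp add: r_def)
  then obtain c N k0 where cN: "\<And>j. ?P (r j) (c j) (N j) (k0 j)" by metis
  have agree: "cmod (c i - c j) \<le> r i + r j" for i j
    by (rule mean_limits_agree[of "N i" "k0 i" "\<lambda>k. T (Suc k) k" _ _ "N j" "k0 j"]) (use cN in auto)
  have r0: "r \<longlonglongrightarrow> 0" unfolding r_def by (rule LIMSEQ_inverse_real_of_nat)
  have "Cauchy c"
  proof (rule CauchyI)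
    fix e :: real assume "e > 0"
    then have "\<forall>\<^sub>F j in sequentially. r j < e/2"
      using r0 by (intro order_tendstoD) auto
    then obtain M where M: "\<And>j. j \<ge> M \<Longrightarrow> r j < e/2" by (auto simp: eventually_sequentially)
    have "cmod (c m - c n) < e" if "m \<ge> M" "n \<ge> M" for m n
      using agree[of m n] M[OF that(1)] M[OF that(2)] by linarith
    then show "\<exists>M. \<forall>m\<ge>M. \<forall>n\<ge>M. cmod (c m - c n) < e" by blast
  qed
  then obtain c0 where c0: "c \<longlonglongrightarrow> c0" using convergentI Cauchy_convergent convergent_def by blast
  have lim: "cmod (c i - c0) \<le> r i" for i
  proof (rule LIMSEQ_le)
    show "(\<lambda>j. cmod (c i - c j)) \<longlonglongrightarrow> cmod (c i - c0)" by (intro tendsto_intros c0)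
    have "(\<lambda>j. r i + r j) \<longlonglongrightarrow> r i + 0" by (intro tendsto_intros r0)
    then show "(\<lambda>j. r i + r j) \<longlonglongrightarrow> r i" by simp
  qed (use agree in blast)
  show ?thesis
  proof (rule that)
    fix e :: real assume "e > 0"
    then have "\<forall>\<^sub>F j in sequentially. r j < e/2"
      using r0 by (intro order_tendstoD) auto
    then obtain j where j: "r j < e/2" by (auto simp: eventually_sequentially)
    have "cmod ((\<Sum>l<N j. T (Suc (k + l)) (k + l)) / of_nat (N j) - c0) \<le> e" if "k \<ge> k0 j" for k
    proof -
      have "cmod ((\<Sum>l<N j. T (Suc (k + l)) (k + l)) / of_nat (N j) - c j) \<le> r j"
        using cN[of j] that by blast
      then show ?thesis
        using lim[of j] j norm_triangle_ineq[of "(\<Sum>l<N j. T (Suc (k + l)) (k + l)) / of_nat (N j) - c j" "c j - c0"]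
        by simp
    qed
    then show "\<exists>N>0. \<exists>k0. \<forall>k\<ge>k0. cmod ((\<Sum>l<N. T (Suc (k + l)) (k + l)) / of_nat N - c0) \<le> e"
      using cN[of j] by blast
  qed
qed

section \<open>Fejer multipliers\<close>

text \<open>Fourier coefficients of the Fejer kernel, zero for \<open>\<bar>n\<bar> \<ge> N\<close>
  when \<open>N > 0\<close>. At \<open>N = 0\<close> division by zero makes them all 1, whence
  \<open>Suc N\<close> in the limits below.\<close>

definition fejer :: "nat \<Rightarrow> int \<Rightarrow> real" where
  "fejer N n = max 0 (1 - \<bar>real_of_int n\<bar> / real N)"

text \<open>Two integers share a window of length \<open>N\<close> in
  \<open>N - \<bar>a - b\<bar>\<close> positions, or in none if they are too far apart.\<close>

lemma fejer_window:
  assumes "0 < N"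
  shows "real (card {m::int. 0 \<le> a + m \<and> a + m < int N \<and> 0 \<le> b + m \<and> b + m < int N}) = real N * fejer N (a - b)"
proof -
  have "{m::int. 0 \<le> a + m \<and> a + m < int N \<and> 0 \<le> b + m \<and> b + m < int N} =
      {max (- a) (- b)..<min (int N - a) (int N - b)}" by auto
  then have "real (card {m::int. 0 \<le> a + m \<and> a + m < int N \<and> 0 \<le> b + m \<and> b + m < int N}) =
      max 0 (real_of_int (min (int N - a) (int N - b) - max (- a) (- b)))"
    by simp
  also have "\<dots> = max 0 (real N - \<bar>real_of_int (a - b)\<bar>)"
    by (auto simp: min_def max_def)
  also have "\<dots> = real N * fejer N (a - b)"
    using assms by (auto simp: fejer_def max_def field_simps)
  finally show ?thesis .
qed

text \<open>The Fejer multiplier averages the compressions of \<open>T\<close> to all windows of length \<open>N\<close>.\<close>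

lemma op_bound_fejer:
  assumes T: "op_bound C T" and N: "0 < N"
  shows "op_bound C (\<lambda>i j. of_real (fejer N (int i - int j - s)) * T i j)"
proof (rule op_boundI)
  fix F :: "nat set" and v w :: "nat \<Rightarrow> complex"
  assume F: "finite F" "(\<Sum>j\<in>F. (cmod (v j))\<^sup>2) \<le> 1" "(\<Sum>i\<in>F. (cmod (w i))\<^sup>2) \<le> 1"
  have C0: "0 \<le> C" by (rule op_bound_nonneg[OF T])
  \<comment> \<open>Indicator of the window with offset \<open>m\<close>. Columns use the window
    displaced by \<open>s\<close>, which centres the weights on the diagonal
    \<open>s\<close>.\<close>
  define In where "In a m = (if 0 \<le> a + m \<and> a + m < int N then 1 else 0 :: real)" for a m
  \<comment> \<open>Large enough that \<open>{-R..R}\<close> contains every offset whose window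
    meets \<open>F\<close>.\<close>
  define R where "R = (\<Sum>i\<in>F. int i) + int N + \<bar>s\<bar>"
  have le: "int i \<le> (\<Sum>i\<in>F. int i)" if "i \<in> F" for i
    using F(1) that by (intro member_le_sum) auto
  have cardR: "(\<Sum>m\<in>{-R..R}. In (int i) m * In (int j + s) m) = real N * fejer N (int i - (int j + s))"
    if "i \<in> F" for i j
  proof -
    have "(\<Sum>m\<in>{-R..R}. In (int i) m * In (int j + s) m) =
        real (card ({-R..R} \<inter> {m. 0 \<le> int i + m \<and> int i + m < int N \<and> 0 \<le> int j + s + m \<and> int j + s + m < int N}))"
    proof -
      have "In (int i) m * In (int j + s) m =
          (if 0 \<le> int i + m \<and> int i + m < int N \<and> 0 \<le> int j + s + m \<and> int j + s + m < int N then 1 else 0)" for m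
        by (simp add: In_def)
      then show ?thesis by (simp add: sum.If_cases)
    qed
    also have "{-R..R} \<inter> {m. 0 \<le> int i + m \<and> int i + m < int N \<and> 0 \<le> int j + s + m \<and> int j + s + m < int N} =
        {m. 0 \<le> int i + m \<and> int i + m < int N \<and> 0 \<le> int j + s + m \<and> int j + s + m < int N}"
      using le[OF that] by (auto simp: R_def)
    finally show ?thesis by (simp add: fejer_window[OF N])
  qed
  have card1: "(\<Sum>m\<in>{-R..R}. In a m) \<le> real N" for a
  proof -
    have "(\<Sum>m\<in>{-R..R}. In a m) = real (card ({-R..R} \<inter> {m. 0 \<le> a + m \<and> a + m < int N}))"
      by (simp add: In_def sum.If_cases)
    also have "card ({-R..R} \<inter> {m. 0 \<le> a + m \<and> a + m < int N}) \<le> card {-a..<int N - a}"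
      by (intro card_mono) auto
    finally show ?thesis by simp
  qed
  let ?W = "\<lambda>m i. of_real (In (int i) m) * w i" and ?V = "\<lambda>m j. of_real (In (int j + s) m) * v j"
  have "of_nat N * (\<Sum>i\<in>F. \<Sum>j\<in>F. cnj (w i) * (of_real (fejer N (int i - int j - s)) * T i j) * v j) =
      (\<Sum>i\<in>F. \<Sum>j\<in>F. of_real (\<Sum>m\<in>{-R..R}. In (int i) m * In (int j + s) m) * (cnj (w i) * T i j * v j))"
    unfolding sum_distrib_left by (intro sum.cong refl) (simp only: cardR, simp add: diff_diff_eq mult_ac)
  also have "\<dots> = (\<Sum>i\<in>F. \<Sum>j\<in>F. \<Sum>m\<in>{-R..R}. cnj (?W m i) * T i j * ?V m j)"
    by (simp add: sum_distrib_left mult_ac)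
  also have "\<dots> = (\<Sum>m\<in>{-R..R}. \<Sum>i\<in>F. \<Sum>j\<in>F. cnj (?W m i) * T i j * ?V m j)"
    by (subst (2) sum.swap, subst sum.swap) simp
  finally have avg: "of_nat N * (\<Sum>i\<in>F. \<Sum>j\<in>F. cnj (w i) * (of_real (fejer N (int i - int j - s)) * T i j) * v j) =
      (\<Sum>m\<in>{-R..R}. \<Sum>i\<in>F. \<Sum>j\<in>F. cnj (?W m i) * T i j * ?V m j)" .
  have "real N * cmod (\<Sum>i\<in>F. \<Sum>j\<in>F. cnj (w i) * (of_real (fejer N (int i - int j - s)) * T i j) * v j) =
      cmod (\<Sum>m\<in>{-R..R}. \<Sum>i\<in>F. \<Sum>j\<in>F. cnj (?W m i) * T i j * ?V m j)"
    unfolding avg[symmetric] by (simp only: norm_mult norm_of_nat)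
  also have "\<dots> \<le> (\<Sum>m\<in>{-R..R}. C * ((\<Sum>j\<in>F. In (int j + s) m * (cmod (v j))\<^sup>2) / 2 +
      (\<Sum>i\<in>F. In (int i) m * (cmod (w i))\<^sup>2) / 2))"
  proof (intro sum_norm_le)
    \<comment> \<open>On one window the bound \<open>C\<close> applies to the truncated vectors, and
      the product of their norms is at most half the sum of squares. Summing over \<open>m\<close>
      counts each index at most \<open>N\<close> times, which matches the factor \<open>N\<close> on
      the left.\<close>
    fix m
    let ?a = "L2_set (\<lambda>j. cmod (?V m j)) F" and ?b = "L2_set (\<lambda>i. cmod (?W m i)) F"
    have "cmod (\<Sum>i\<in>F. \<Sum>j\<in>F. cnj (?W m i) * T i j * ?V m j) \<le> C * ?a * ?b"
      by (rule op_bound_two[OF T F(1) F(1)])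
    also have "\<dots> \<le> C * (?a\<^sup>2 / 2 + ?b\<^sup>2 / 2)"
      using sum_squares_bound[of ?a ?b] C0 by (simp add: mult.assoc mult_left_mono)
    also have "?a\<^sup>2 = (\<Sum>j\<in>F. In (int j + s) m * (cmod (v j))\<^sup>2)"
      by (auto simp: L2_set_def sum_nonneg In_def norm_mult intro!: sum.cong)
    also have "?b\<^sup>2 = (\<Sum>i\<in>F. In (int i) m * (cmod (w i))\<^sup>2)"
      by (auto simp: L2_set_def sum_nonneg In_def norm_mult intro!: sum.cong)
    finally show "cmod (\<Sum>i\<in>F. \<Sum>j\<in>F. cnj (?W m i) * T i j * ?V m j) \<le>
        C * ((\<Sum>j\<in>F. In (int j + s) m * (cmod (v j))\<^sup>2) / 2 + (\<Sum>i\<in>F. In (int i) m * (cmod (w i))\<^sup>2) / 2)" .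
  qed
  also have "\<dots> = C * ((\<Sum>m\<in>{-R..R}. \<Sum>j\<in>F. In (int j + s) m * (cmod (v j))\<^sup>2) / 2 +
      (\<Sum>m\<in>{-R..R}. \<Sum>i\<in>F. In (int i) m * (cmod (w i))\<^sup>2) / 2)"
    by (simp add: sum_distrib_left[symmetric] sum.distrib sum_divide_distrib[symmetric])
  also have "\<dots> = C * ((\<Sum>j\<in>F. (\<Sum>m\<in>{-R..R}. In (int j + s) m) * (cmod (v j))\<^sup>2) / 2 +
      (\<Sum>i\<in>F. (\<Sum>m\<in>{-R..R}. In (int i) m) * (cmod (w i))\<^sup>2) / 2)"
    by (subst (1 2) sum.swap) (simp add: sum_distrib_right)
  also have "\<dots> \<le> C * ((\<Sum>j\<in>F. real N * (cmod (v j))\<^sup>2) / 2 + (\<Sum>i\<in>F. real N * (cmod (w i))\<^sup>2) / 2)"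
    using C0 by (intro mult_left_mono add_mono divide_right_mono sum_mono mult_right_mono card1) auto
  also have "\<dots> = real N * (C * ((\<Sum>j\<in>F. (cmod (v j))\<^sup>2) / 2 + (\<Sum>i\<in>F. (cmod (w i))\<^sup>2) / 2))"
    by (simp add: sum_distrib_left[symmetric] algebra_simps)
  also have "\<dots> \<le> real N * (C * 1)"
    using F C0 by (intro mult_left_mono) auto
  finally show "cmod (\<Sum>i\<in>F. \<Sum>j\<in>F. cnj (w i) * (of_real (fejer N (int i - int j - s)) * T i j) * v j) \<le> C"
    using N by simp
qed

lemma fejer_bound: "\<bar>1 - fejer N n\<bar> \<le> \<bar>real_of_int n\<bar> / real N"
  by (auto simp: fejer_def max_def)

text \<open>On a banded approximant \<open>S\<close> the weights tend to 1 at rate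
  \<open>1 / N\<close>; the error \<open>T - S\<close> is handled by the contractivity of the
  multiplier. The shift \<open>s\<close> serves commutators with elements of degree
  \<open>s\<close>.\<close>

lemma fejer_converges:
  fixes x1 :: "'g::topological_ab_group_add"
  assumes comp: "compact (UNIV :: 'g set)" and T: "T \<in> algA x1" and e: "e > 0"
  shows "\<exists>N0. \<forall>N\<ge>N0. op_bound e (\<lambda>i j. of_real (1 - fejer (Suc N) (int i - int j - s)) * T i j)"
proof -
  from e have e3: "e/3 > 0" by simp
  then obtain S where S: "S \<in> starAlgC x1" "op_bound (e/3) (msub T S)"
    using T unfolding algA_iff[OF comp] by blast
  obtain C where C: "op_bound C S" using starAlgC_bounded[OF comp S(1)] ..
  obtain B where B: "banded B S" using starAlgC_banded[OF S(1)] ..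
  have C0: "0 \<le> C" by (rule op_bound_nonneg[OF C])
  \<comment> \<open>Number of diagonals in the band, times a bound for
    \<open>\<bar>n - s\<bar>\<close> on them, times the entry bound of \<open>S\<close>; the weights
    then change \<open>S\<close> by at most \<open>Q / Suc N\<close>.\<close>
  define Q where "Q = real (2 * B + 1) * (real B + \<bar>real_of_int s\<bar>) * C"
  obtain N0 :: nat where N0: "Q / (e/3) < real N0" using reals_Archimedean2 by blast
  have "op_bound e (\<lambda>i j. of_real (1 - fejer (Suc N) (int i - int j - s)) * T i j)" if "N \<ge> N0" for N
  proof -
    let ?w = "\<lambda>i j. fejer (Suc N) (int i - int j - s)"
    let ?S = "\<lambda>i j. of_real (1 - ?w i j) * S i j"
    have "cmod (?S i j) \<le> (real B + \<bar>real_of_int s\<bar>) / real (Suc N) * C" for i j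
    proof (cases "S i j = 0")
      case False
      then have "i \<le> j + B \<and> j \<le> i + B" using B by (auto simp: banded_def)
      then have "\<bar>int i - int j - s\<bar> \<le> int B + \<bar>s\<bar>" by linarith
      then have "\<bar>real_of_int (int i - int j - s)\<bar> \<le> real B + \<bar>real_of_int s\<bar>" by linarith
      then have "\<bar>1 - ?w i j\<bar> \<le> (real B + \<bar>real_of_int s\<bar>) / real (Suc N)"
        by (intro order_trans[OF fejer_bound] divide_right_mono) auto
      then show ?thesis
        unfolding norm_mult norm_of_real by (intro mult_mono op_bound_entry[OF C]) auto
    qed (use C0 in auto)
    moreover have "banded B ?S" using B by (auto simp: banded_def)
    ultimately have "op_bound (real (2 * B + 1) * ((real B + \<bar>real_of_int s\<bar>) / real (Suc N) * C)) ?S"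
      by (intro banded_op_bound)
    moreover have "real (2 * B + 1) * ((real B + \<bar>real_of_int s\<bar>) / real (Suc N) * C) \<le> e/3"
    proof -
      have "Q \<le> e/3 * real (Suc N)"
      proof -
        have "Q \<le> e/3 * real N0" using N0 e3 by (simp add: field_simps)
        also have "\<dots> \<le> e/3 * real (Suc N)" using that e3 by (intro mult_left_mono) auto
        finally show ?thesis .
      qed
      then have "Q / real (Suc N) \<le> e/3" by (simp add: divide_le_eq)
      then show ?thesis by (simp add: Q_def)
    qed
    ultimately have 1: "op_bound (e/3) ?S" by (rule op_bound_mono)
    have 2: "op_bound (e/3) (\<lambda>i j. of_real (?w i j) * msub T S i j)"
      by (rule op_bound_fejer[OF S(2)]) simp
    \<comment> \<open>With \<open>w\<close> the weights,
      \<open>(1 - w) T = (1 - w) S + (T - S) - w (T - S)\<close>, each term bounded by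
      \<open>e/3\<close>.\<close>
    have "op_bound (e/3 + (e/3 + e/3)) (madd ?S (msub (msub T S) (\<lambda>i j. of_real (?w i j) * msub T S i j)))"
      by (intro op_bound_add op_bound_sub 1 2 S(2))
    moreover have "madd ?S (msub (msub T S) (\<lambda>i j. of_real (?w i j) * msub T S i j)) =
        (\<lambda>i j. of_real (1 - ?w i j) * T i j)"
      by (auto simp: madd_def msub_def fun_eq_iff algebra_simps)
    ultimately show ?thesis by simp
  qed
  then show ?thesis by blast
qed

section \<open>Derivations\<close>

lemma derivation_sum:
  assumes d: "is_derivation x1 d" and "finite K" "\<And>k. k \<in> K \<Longrightarrow> M k \<in> calA x1"
  shows "(\<lambda>i j. \<Sum>k\<in>K. M k i j) \<in> calA x1 \<and>
    d (\<lambda>i j. \<Sum>k\<in>K. M k i j) = (\<lambda>i j. \<Sum>k\<in>K. d (M k) i j)"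
  using assms(2,3)
proof (induction K rule: finite_induct)
  case empty
  \<comment> \<open>The zero matrix is reached as a multiple of a generator, where homogeneity gives
    the value of \<open>d\<close>.\<close>
  have "msmult 0 shiftU \<in> calA x1" "d (msmult 0 shiftU) = msmult 0 (d shiftU)"
    using d calA.gen_U[of x1] unfolding is_derivation_def by (blast intro: calA.smult)+
  then show ?case by (simp add: msmult_def)
next
  case (insert k K)
  let ?R = "\<lambda>i j. \<Sum>k\<in>K. M k i j"
  have Mk: "M k \<in> calA x1" and R: "?R \<in> calA x1" "d ?R = (\<lambda>i j. \<Sum>k\<in>K. d (M k) i j)"
    using insert by auto
  have "d (madd (M k) ?R) = madd (d (M k)) (d ?R)"
    using d Mk R(1) unfolding is_derivation_def by blast
  moreover have "madd (M k) ?R \<in> calA x1" by (intro calA.add Mk R)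
  ultimately show ?case
    using insert.hyps R(2) by (simp add: madd_def)
qed

text \<open>Apply \<open>d\<close> to \<open>a * munit j 0\<close>.  The matrix on the right need not be a bounded operator.\<close>

lemma derivation_eq_mcomm:
  assumes d: "is_derivation x1 d" and a: "a \<in> calA x1"
  shows "d a = mcomm (\<lambda>i j. d (munit j 0) i 0) a"
proof (intro ext)
  fix i j
  define X where "X = (\<lambda>i j. d (munit j 0) i 0)"
  obtain B where B: "banded B a" using starAlgC_banded[OF calA_subset_starAlgC[OF a]] ..
  let ?M = "Suc (j + B)" and ?L = "Suc (i + B)"
  \<comment> \<open>By the band of \<open>a\<close> its \<open>j\<close>-th column is a finite
    combination of matrix units, to which finite linearity of \<open>d\<close> applies.\<close>
  have "mmult a (munit j 0) = (\<lambda>p q. \<Sum>k<?M. msmult (a k j) (munit k 0) p q)"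
  proof (intro ext)
    fix p q
    have "mmult a (munit j 0) p q = (\<Sum>k\<in>{j}. a p k * munit j 0 k q)"
      by (rule mmult_right) (auto simp: munit_def)
    also have "\<dots> = (if q = 0 then a p j else 0)" by (simp add: munit_def)
    also have "\<dots> = (\<Sum>k<?M. if k = p then (if q = 0 then a p j else 0) else 0)"
      using bandedD(1)[OF B, of j p] by (auto simp: not_less simp del: sum.lessThan_Suc)
    also have "\<dots> = (\<Sum>k<?M. msmult (a k j) (munit k 0) p q)"
      by (intro sum.cong) (auto simp: msmult_def munit_def)
    finally show "mmult a (munit j 0) p q = (\<Sum>k<?M. msmult (a k j) (munit k 0) p q)" .
  qed
  then have "d (mmult a (munit j 0)) = (\<lambda>p q. \<Sum>k<?M. d (msmult (a k j) (munit k 0)) p q)"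
    using derivation_sum[OF d finite_lessThan calA.smult[OF munit_calA], of "\<lambda>k. a k j" "\<lambda>k. k" "\<lambda>_. 0" ?M]
    by (simp del: sum.lessThan_Suc)
  moreover have "d (msmult c (munit k 0)) = msmult c (d (munit k 0))" for c k
    using d munit_calA unfolding is_derivation_def by blast
  ultimately have "d (mmult a (munit j 0)) i 0 = (\<Sum>k<?M. a k j * X i k)"
    by (simp add: msmult_def X_def del: sum.lessThan_Suc)
  also have "\<dots> = mmult X a i j"
    by (simp add: mmult_banded_right[OF B, where M = ?M] mult.commute del: sum.lessThan_Suc)
  finally have 1: "d (mmult a (munit j 0)) i 0 = mmult X a i j" .
  have 2: "d (mmult a (munit j 0)) = madd (mmult a (d (munit j 0))) (mmult (d a) (munit j 0))"
    using d a munit_calA unfolding is_derivation_def by blast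
  have 3: "mmult a (d (munit j 0)) i 0 = mmult a X i j"
    by (simp add: mmult_banded_left[OF B, where M = ?L] X_def del: sum.lessThan_Suc)
  have 4: "mmult (d a) (munit j 0) i 0 = d a i j"
    using mmult_right[of "{j}" "munit j 0" 0 "d a" i] by (simp add: munit_def)
  have "mmult X a i j = mmult a X i j + d a i j"
    using 1 2 3 4 by (simp add: madd_def)
  then show "d a i j = mcomm (\<lambda>i j. d (munit j 0) i 0) a i j"
    by (simp add: mcomm_def msub_def flip: X_def)
qed

text \<open>Entry \<open>(i, j)\<close> of a commutator with an element of degree \<open>s\<close>
  involves only entries of \<open>X\<close> on the diagonal \<open>int i - int j - s\<close>, where
  the multiplier is constant. So damping the diagonals of \<open>X\<close> damps those of
  \<open>mcomm X a\<close>, even for unbounded \<open>X\<close>.\<close>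

lemma mcomm_multiplier:
  assumes a: "\<And>i j. a i j \<noteq> 0 \<Longrightarrow> int i - int j = s"
    and P: "\<And>i j. P i j = \<psi> (int i - int j) * X i j"
  shows "mcomm P a i j = \<psi> (int i - int j - s) * mcomm X a i j"
proof -
  have "finite {k. a k j \<noteq> 0}" "finite {k. a i k \<noteq> 0}"
  proof -
    have "k = nat (int j + s)" if "a k j \<noteq> 0" for k using a[OF that] by linarith
    then show "finite {k. a k j \<noteq> 0}" by (auto intro!: finite_subset[of _ "{nat (int j + s)}"])
    have "k = nat (int i - s)" if "a i k \<noteq> 0" for k using a[OF that] by linarith
    then show "finite {k. a i k \<noteq> 0}" by (auto intro!: finite_subset[of _ "{nat (int i - s)}"])
  qed
  then have r: "mmult Y a i j = (\<Sum>k | a k j \<noteq> 0. Y i k * a k j)"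
    and l: "mmult a Y i j = (\<Sum>k | a i k \<noteq> 0. a i k * Y k j)" for Y
    by (auto intro: mmult_right mmult_left)
  have "mmult P a i j = \<psi> (int i - int j - s) * mmult X a i j"
    unfolding r sum_distrib_left
  proof (intro sum.cong refl)
    fix k assume "k \<in> {k. a k j \<noteq> 0}"
    then have "int i - int k = int i - int j - s" using a[of k j] by simp
    then show "P i k * a k j = \<psi> (int i - int j - s) * (X i k * a k j)"
      unfolding P by (simp only: mult_ac)
  qed
  moreover have "mmult a P i j = \<psi> (int i - int j - s) * mmult a X i j"
    unfolding l sum_distrib_left
  proof (intro sum.cong refl)
    fix k assume "k \<in> {k. a i k \<noteq> 0}"
    then have "int k - int j = int i - int j - s" using a[of i k] by simp
    then show "a i k * P k j = \<psi> (int i - int j - s) * (a i k * X k j)"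
      unfolding P by (simp only: mult_ac)
  qed
  ultimately show ?thesis by (simp add: mcomm_def msub_def right_diff_distrib)
qed

lemma mcomm_mdiag: "mcomm (mdiag g) a i j = (g i - g j) * a i j"
  by (simp add: mcomm_def msub_def algebra_simps)

lemma mcomm_add_left:
  assumes "banded B a"
  shows "mcomm (madd Y Z) a = madd (mcomm Y a) (mcomm Z a)"
proof -
  have "madd Y Z = msub Y (msub (\<lambda>i j. 0) Z)" by (simp add: madd_def msub_def)
  moreover have "mcomm (\<lambda>i j. 0) a = (\<lambda>i j. 0)" by (simp add: mcomm_def msub_def mmult_def)
  ultimately show ?thesis
    by (simp add: mcomm_msub_left[OF assms]) (simp add: madd_def msub_def)
qed

lemma Kcomm_calA: "a \<in> calA x1 \<Longrightarrow> Kcomm a \<in> calA x1"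
proof (induction rule: calA.induct)
  case gen_U
  have "Kcomm shiftU = shiftU" by (auto simp: Kcomm_def shiftU_def fun_eq_iff)
  then show ?case by (simp add: calA.gen_U)
next
  case gen_Ustar
  have "Kcomm (madj shiftU) = msmult (-1) (madj shiftU)"
    by (auto simp: Kcomm_def shiftU_def madj_def msmult_def fun_eq_iff)
  then show ?case by (simp add: calA.gen_Ustar calA.smult)
next
  case (gen_chi ch)
  have "Kcomm (Mdiag x1 ch) = msmult 0 shiftU"
    by (auto simp: Kcomm_def Mdiag_def msmult_def fun_eq_iff)
  then show ?case by (simp add: calA.gen_U calA.smult)
next
  case (add a b)
  have "Kcomm (madd a b) = madd (Kcomm a) (Kcomm b)"
    by (auto simp: Kcomm_def madd_def fun_eq_iff algebra_simps)
  with add show ?case by (simp add: calA.add)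
next
  case (smult a c)
  have "Kcomm (msmult c a) = msmult c (Kcomm a)"
    by (auto simp: Kcomm_def msmult_def fun_eq_iff algebra_simps)
  with smult show ?case by (simp add: calA.smult)
next
  case (mult a b)
  obtain B where B: "banded B a" using starAlgC_banded[OF calA_subset_starAlgC[OF mult.hyps(1)]] ..
  obtain C where C: "banded C b" using starAlgC_banded[OF calA_subset_starAlgC[OF mult.hyps(2)]] ..
  have "Kcomm (mmult a b) = madd (mmult a (Kcomm b)) (mmult (Kcomm a) b)"
    unfolding Kcomm_conv by (rule mcomm_mult[OF B C])
  with mult show ?case by (simp add: calA.add calA.mult)
next
  case (adj a)
  have "Kcomm (madj a) = msmult (-1) (madj (Kcomm a))"
    by (auto simp: Kcomm_def madj_def msmult_def fun_eq_iff algebra_simps)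
  with adj show ?case by (simp add: calA.smult calA.adj)
qed

text \<open>Convergence passes to sums and products but a priori not to adjoints, so the induction
  carries \<open>a\<close> and \<open>madj a\<close> together.\<close>

lemma mcomm_convergence_calA:
  fixes x1 :: "'g::topological_ab_group_add" and Z :: "nat \<Rightarrow> mat"
  defines "conv a \<equiv> \<forall>e>0. \<exists>N0. \<forall>N\<ge>N0. op_bound e (mcomm (Z N) a)"
  assumes comp: "compact (UNIV :: 'g set)"
    and U: "conv shiftU" and Us: "conv (madj shiftU)"
    and ch: "\<And>ch. character ch \<Longrightarrow> conv (Mdiag x1 ch)"
    and a: "a \<in> calA x1"
  shows "conv a"
proof -
  have cadd: "conv (madd a b)" if ab: "a \<in> calA x1" "b \<in> calA x1" "conv a" "conv b" for a b
    unfolding conv_def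
  proof (intro allI impI)
    obtain A where A: "banded A a" using starAlgC_banded[OF calA_subset_starAlgC[OF ab(1)]] ..
    obtain B where B: "banded B b" using starAlgC_banded[OF calA_subset_starAlgC[OF ab(2)]] ..
    fix e :: real assume "e > 0"
    then have "e/2 > 0" by simp
    then obtain N1 N2 where N: "\<And>N. N \<ge> N1 \<Longrightarrow> op_bound (e/2) (mcomm (Z N) a)"
        "\<And>N. N \<ge> N2 \<Longrightarrow> op_bound (e/2) (mcomm (Z N) b)"
      using ab(3,4) unfolding conv_def by meson
    have "op_bound e (mcomm (Z N) (madd a b))" if "N \<ge> max N1 N2" for N
      using op_bound_add[OF N(1) N(2), of N N] that by (simp add: mcomm_add[OF A B])
    then show "\<exists>N0. \<forall>N\<ge>N0. op_bound e (mcomm (Z N) (madd a b))" by blast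
  qed
  have csm: "conv (msmult c a)" if a: "a \<in> calA x1" "conv a" for a c
    unfolding conv_def
  proof (intro allI impI)
    obtain A where A: "banded A a" using starAlgC_banded[OF calA_subset_starAlgC[OF a(1)]] ..
    fix e :: real assume e: "e > 0"
    define e' where "e' = e / (cmod c + 1)"
    have p: "cmod c + 1 > 0" using norm_ge_zero[of c] by linarith
    have "e' > 0" using e p by (simp add: e'_def)
    then obtain N1 where N: "\<And>N. N \<ge> N1 \<Longrightarrow> op_bound e' (mcomm (Z N) a)"
      using a(2) unfolding conv_def by meson
    have "cmod c * e' \<le> e" using e p by (simp add: e'_def field_simps)
    then have "op_bound e (mcomm (Z N) (msmult c a))" if "N \<ge> N1" for N
      using op_bound_mono[OF op_bound_smult[OF N[OF that], of c]] by (simp add: mcomm_smult[OF A])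
    then show "\<exists>N0. \<forall>N\<ge>N0. op_bound e (mcomm (Z N) (msmult c a))" by blast
  qed
  have cmul: "conv (mmult a b)" if ab: "a \<in> calA x1" "b \<in> calA x1" "conv a" "conv b" for a b
    unfolding conv_def
  proof (intro allI impI)
    obtain A where A: "banded A a" using starAlgC_banded[OF calA_subset_starAlgC[OF ab(1)]] ..
    obtain B where B: "banded B b" using starAlgC_banded[OF calA_subset_starAlgC[OF ab(2)]] ..
    obtain p where p: "op_bound p a" using starAlgC_bounded[OF comp calA_subset_starAlgC[OF ab(1)]] ..
    obtain q where q: "op_bound q b" using starAlgC_bounded[OF comp calA_subset_starAlgC[OF ab(2)]] ..
    have pq: "0 \<le> p" "0 \<le> q" using p q op_bound_nonneg by auto
    fix e :: real assume e: "e > 0"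
    \<comment> \<open>The two Leibniz terms cost at most \<open>e' * p\<close> and
      \<open>e' * q\<close>; the summand 1 keeps the divisor positive.\<close>
    define e' where "e' = e / (p + q + 1)"
    have "e' > 0" using e pq by (simp add: e'_def)
    then obtain N1 N2 where N: "\<And>N. N \<ge> N1 \<Longrightarrow> op_bound e' (mcomm (Z N) a)"
        "\<And>N. N \<ge> N2 \<Longrightarrow> op_bound e' (mcomm (Z N) b)"
      using ab(3,4) unfolding conv_def by meson
    have le: "e' * p + e' * q \<le> e"
    proof -
      have "e' * p + e' * q \<le> e' * (p + q + 1)" using \<open>e' > 0\<close> by (simp add: algebra_simps)
      also have "\<dots> = e" using pq by (simp add: e'_def)
      finally show ?thesis .
    qed
    have "op_bound e (mcomm (Z N) (mmult a b))" if "N \<ge> max N1 N2" for N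
    proof -
      have "op_bound (e' * p + e' * q) (madd (mmult a (mcomm (Z N) b)) (mmult (mcomm (Z N) a) b))"
        using that by (intro op_bound_add op_bound_mult_left[OF N(2) p A] op_bound_mult_right[OF N(1) q B]) auto
      from op_bound_mono[OF this le] show ?thesis unfolding mcomm_mult[OF A B] .
    qed
    then show "\<exists>N0. \<forall>N\<ge>N0. op_bound e (mcomm (Z N) (mmult a b))" by blast
  qed
  from a have "conv a \<and> conv (madj a)"
  proof (induction rule: calA.induct)
    case (gen_chi ch')
    have "madj (Mdiag x1 ch') = Mdiag x1 (\<lambda>x. cnj (ch' x))" by (simp add: Mdiag_conv madj_mdiag)
    then show ?case using ch gen_chi character_cnj by metis
  next
    case (add a b)
    have "madj (madd a b) = madd (madj a) (madj b)" by (simp add: madj_def madd_def)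
    with add show ?case using cadd calA.adj by metis
  next
    case (smult a c)
    have "madj (msmult c a) = msmult (cnj c) (madj a)" by (simp add: madj_def msmult_def)
    with smult show ?case using csm calA.adj by metis
  next
    case (mult a b)
    obtain B where B: "banded B b" using starAlgC_banded[OF calA_subset_starAlgC[OF mult.hyps(2)]] ..
    have "madj (mmult a b) = mmult (madj b) (madj a)" by (rule madj_mmult[OF B])
    with mult show ?case using cmul calA.adj by metis
  qed (use U Us in auto)
  then show ?thesis ..
qed

section \<open>Decomposition of a derivation\<close>

context monothetic
begin

text \<open>The commutator with \<open>Mdiag x1 ch\<close> has entries
  \<open>X i j * (z ^ j - z ^ i)\<close>, on the diagonal \<open>n\<close> equal to
  \<open>X i j * (1 - u) * z ^ j\<close>. Both factors are removed inside \<open>algA\<close>, the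
  power \<open>z ^ j\<close> by multiplying with the conjugate character.\<close>

lemma derivation_offdiagonal_algA:
  assumes inf: "infinite (UNIV :: 'g set)"
    and X: "\<And>ch. character ch \<Longrightarrow> mcomm X (Mdiag x1 ch) \<in> algA x1" and n: "n \<noteq> 0"
  shows "dpart n X \<in> algA x1"
proof -
  obtain ch where ch: "character ch" "ch x1 ^ nat \<bar>n\<bar> \<noteq> 1"
    using exists_character_aperiodic[OF inf, of "nat \<bar>n\<bar>"] n by auto
  define z where "z = ch x1"
  have z1: "cmod z = 1" using ch(1) by (simp add: z_def character_def)
  then have z0: "z \<noteq> 0" by auto
  have zc: "z ^ j * cnj z ^ j = 1" for j
    using z1 by (simp add: power_mult_distrib[symmetric] complex_norm_square[symmetric])
  \<comment> \<open>The value of the character at \<open>zmul n x1\<close>; an integer power because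
    \<open>n\<close> may be negative.\<close>
  define u where "u = z powi n"
  have "u \<noteq> 1"
  proof (cases "0 \<le> n")
    case True
    then show ?thesis using ch(2) by (simp add: u_def z_def power_int_def)
  next
    case False
    then show ?thesis using ch(2) by (simp add: u_def z_def power_int_def inverse_eq_1_iff power_inverse)
  qed
  have pow: "z ^ i = u * z ^ j" if "int i - int j = n" for i j
  proof -
    have "z powi int i = z powi (n + int j)" using that by (simp add: algebra_simps)
    then show ?thesis using z0 by (simp add: power_int_add u_def)
  qed
  have "msmult (1 / (1 - u)) (mmult (dpart n (mcomm X (Mdiag x1 ch))) (Mdiag x1 (\<lambda>x. cnj (ch x)))) \<in> algA x1"
    using character_cnj[OF ch(1)]
    by (intro algA_smult[OF compact_group] algA_mult_right[OF compact_group] algA_dpart[OF compact_group]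
        X ch(1) starAlgC.gen_f) (auto simp: character_def)
  moreover have "msmult (1 / (1 - u)) (mmult (dpart n (mcomm X (Mdiag x1 ch))) (Mdiag x1 (\<lambda>x. cnj (ch x)))) = dpart n X"
  proof (intro ext)
    fix i j
    show "msmult (1 / (1 - u)) (mmult (dpart n (mcomm X (Mdiag x1 ch))) (Mdiag x1 (\<lambda>x. cnj (ch x)))) i j = dpart n X i j"
    proof (cases "int i - int j = n")
      case True
      have "mcomm X (Mdiag x1 ch) i j = X i j * (z ^ j - z ^ i)"
        by (simp add: mcomm_def msub_def Mdiag_conv character_natmul[OF ch(1)] algebra_simps flip: z_def)
      also have "\<dots> = X i j * (1 - u) * z ^ j"
        by (simp add: pow[OF True] algebra_simps)
      finally have "mcomm X (Mdiag x1 ch) i j * cnj z ^ j = X i j * (1 - u)"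
        using zc[of j] by (simp add: mult.assoc)
      then show ?thesis
        using True \<open>u \<noteq> 1\<close> by (simp add: msmult_def dpart_def Mdiag_conv character_natmul[OF ch(1)] flip: z_def)
    qed (simp add: msmult_def dpart_def Mdiag_conv)
  qed
  ultimately show ?thesis by simp
qed

lemma derivation_decomposition:
  assumes inf: "infinite (UNIV :: 'g set)" and d: "is_derivation x1 d"
  shows "\<exists>c0. \<exists>dt. is_derivation x1 dt \<and> approx_inner x1 dt \<and>
    (\<forall>a\<in>calA x1. d a = madd (msmult c0 (Kcomm a)) (dt a))"
proof -
  define X where "X = (\<lambda>i j. d (munit j 0) i 0)"
  have dX: "d a = mcomm X a" if "a \<in> calA x1" for a
    unfolding X_def by (rule derivation_eq_mcomm[OF d that])
  have dA: "d a \<in> algA x1" if "a \<in> calA x1" for a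
    using d that unfolding is_derivation_def by blast
  define \<alpha> where "\<alpha> k = d shiftU (Suc k) k" for k
  have \<alpha>X: "\<alpha> k = X (Suc k) (Suc k) - X k k" for k
    by (simp add: \<alpha>_def dX[OF calA.gen_U] mcomm_def msub_def mmult_shiftU_left mmult_shiftU_right)
  \<comment> \<open>The adjoint shift moves the first subdiagonal of \<open>d shiftU\<close> onto
    the main diagonal.\<close>
  have "mdiag \<alpha> = mmult (madj shiftU) (dpart 1 (d shiftU))"
    by (auto simp: fun_eq_iff mdiag_def mmult_Ustar_left dpart_def \<alpha>_def)
  then have \<alpha>A: "mdiag \<alpha> \<in> algA x1"
    by (simp add: algA_mult_left[OF compact_group] algA_dpart[OF compact_group] dA calA.gen_U
        starAlgC.adj starAlgC.gen_U)
  obtain c where c: "\<And>e. e > 0 \<Longrightarrow> \<exists>N>0. \<exists>k0. \<forall>k\<ge>k0. cmod ((\<Sum>l<N. \<alpha> (k + l)) / of_nat N - c) \<le> e"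
    using algA_diagonal_mean[OF dA[OF calA.gen_U]] unfolding \<alpha>_def by blast
  define r where "r j = inverse (real (Suc j))" for j
  have r0: "r \<longlonglongrightarrow> 0" unfolding r_def by (rule LIMSEQ_inverse_real_of_nat)
  have "\<exists>\<beta>. mdiag \<beta> \<in> algA x1 \<and> (\<forall>k. cmod (\<alpha> k - c - (\<beta> (Suc k) - \<beta> k)) \<le> r j)" for j
  proof -
    have rp: "r j > 0" by (simp add: r_def)
    then obtain N k0 where N: "0 < N" "\<And>k. k \<ge> k0 \<Longrightarrow> cmod ((\<Sum>l<N. \<alpha> (k + l)) / of_nat N - c) \<le> r j"
      using c by blast
    obtain \<beta> where "mdiag \<beta> \<in> algA x1" "\<And>k. cmod (\<alpha> k - c - (\<beta> (Suc k) - \<beta> k)) \<le> r j"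
      using approximate_coboundary[OF compact_group \<alpha>A less_imp_le[OF rp] N] by blast
    then show ?thesis by blast
  qed
  then obtain \<beta> where \<beta>: "\<And>j. mdiag (\<beta> j) \<in> algA x1"
      "\<And>j k. cmod (\<alpha> k - c - (\<beta> j (Suc k) - \<beta> j k)) \<le> r j"
    by metis
  define x where "x N = (\<lambda>i j. if i = j then \<beta> N i else of_real (fejer (Suc N) (int i - int j)) * X i j)" for N
  \<comment> \<open>\<open>Y\<close> implements \<open>dt\<close>. Of its entries,
    \<open>\<gamma> N\<close> is what \<open>\<beta> N\<close> misses on the main diagonal, and
    \<open>P N\<close> what the Fejer weights take off the other diagonals.\<close>
  define Y where "Y = msub X (mdiag (\<lambda>k. c * of_nat k))"
  define dt where "dt a = msub (d a) (msmult c (Kcomm a))" for a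
  define \<gamma> where "\<gamma> N k = X k k - c * of_nat k - \<beta> N k" for N k
  define P where "P N = (\<lambda>i j. of_real (1 - fejer (Suc N) (int i - int j)) * X i j)" for N
  have band: "\<exists>B. banded B a" if "a \<in> calA x1" for a
    using starAlgC_banded[OF calA_subset_starAlgC[OF that]] .
  have dtY: "dt a = mcomm Y a" if a: "a \<in> calA x1" for a
  proof -
    obtain B where B: "banded B a" using band[OF a] ..
    have "mcomm (mdiag (\<lambda>k. c * of_nat k)) a = msmult c (Kcomm a)"
      by (auto simp: fun_eq_iff mcomm_mdiag msmult_def Kcomm_def algebra_simps)
    then show ?thesis
      unfolding dt_def Y_def mcomm_msub_left[OF B] dX[OF a] by simp
  qed
  have "is_derivation x1 dt"
    unfolding is_derivation_def
  proof (intro conjI ballI allI)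
    fix a assume a: "a \<in> calA x1"
    obtain A where A: "banded A a" using band[OF a] ..
    have "msmult c (Kcomm a) \<in> algA x1"
      using a by (intro algA_smult[OF compact_group] starAlgC_subset_algA[OF compact_group]
          calA_subset_starAlgC Kcomm_calA)
    then show "dt a \<in> algA x1"
      unfolding dt_def msub_conv by (intro algA_add[OF compact_group dA[OF a]] algA_smult[OF compact_group, of "msmult c (Kcomm a)"])
    show "dt (msmult k a) = msmult k (dt a)" for k
      by (simp add: dtY a calA.smult mcomm_smult[OF A])
    fix b assume b: "b \<in> calA x1"
    obtain B where B: "banded B b" using band[OF b] ..
    show "dt (madd a b) = madd (dt a) (dt b)"
      by (simp add: dtY a b calA.add mcomm_add[OF A B])
    show "dt (mmult a b) = madd (mmult a (dt b)) (mmult (dt a) b)"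
      by (simp add: dtY a b calA.mult mcomm_mult[OF A B])
  qed
  moreover have "\<forall>a\<in>calA x1. d a = madd (msmult c (Kcomm a)) (dt a)"
    by (simp add: dt_def madd_def msub_def)
  moreover have "approx_inner x1 dt"
    unfolding approx_inner_def
  proof (intro exI conjI allI ballI)
    fix N
    \<comment> \<open>A finite sum, because \<open>fejer (Suc N)\<close> vanishes from
      \<open>Suc N\<close> on; the off-diagonal parts of \<open>X\<close> lie in \<open>algA\<close>
      although \<open>X\<close> itself may be unbounded.\<close>
    have "x N = madd (mdiag (\<beta> N)) (\<lambda>i j. \<Sum>n\<in>{-int (Suc N)..int (Suc N)} - {0}.
        msmult (of_real (fejer (Suc N) n)) (dpart n X) i j)"
    proof (intro ext)
      fix i j
      have "(\<Sum>n\<in>{-int (Suc N)..int (Suc N)} - {0}. msmult (of_real (fejer (Suc N) n)) (dpart n X) i j) =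
          (\<Sum>n\<in>{-int (Suc N)..int (Suc N)} - {0}. if n = int i - int j
            then of_real (fejer (Suc N) (int i - int j)) * X i j else 0)"
        by (intro sum.cong) (auto simp: msmult_def dpart_def)
      also have "\<dots> = (if i = j then 0 else of_real (fejer (Suc N) (int i - int j)) * X i j)"
      proof (cases "int i - int j \<in> {-int (Suc N)..int (Suc N)}")
        case False
        then have "fejer (Suc N) (int i - int j) = 0"
          by (auto simp: fejer_def max_def field_simps)
        then show ?thesis by (auto intro!: sum.neutral)
      qed auto
      finally show "x N i j = madd (mdiag (\<beta> N)) (\<lambda>i j. \<Sum>n\<in>{-int (Suc N)..int (Suc N)} - {0}.
          msmult (of_real (fejer (Suc N) n)) (dpart n X) i j) i j"
        by (simp add: x_def madd_def mdiag_def)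
    qed
    also have "\<dots> \<in> algA x1"
    proof (intro algA_add[OF compact_group] \<beta> algA_sum[OF compact_group] algA_smult[OF compact_group])
      fix n assume "n \<in> {-int (Suc N)..int (Suc N)} - {0}"
      then show "dpart n X \<in> algA x1"
        using dX dA calA.gen_chi by (intro derivation_offdiagonal_algA[OF inf]) force+
    qed simp
    finally show "x N \<in> algA x1" .
  next
    define Z where "Z N = msub Y (x N)" for N
    \<comment> \<open>Since \<open>fejer (Suc N) 0 = 1\<close>, the matrix \<open>P N\<close>
      vanishes on the main diagonal and does not overlap with \<open>\<gamma> N\<close>.\<close>
    have Z: "Z N = madd (P N) (mdiag (\<gamma> N))" for N
      by (auto simp: Z_def Y_def x_def P_def \<gamma>_def msub_def madd_def mdiag_def fun_eq_iff fejer_def algebra_simps)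
    have conv: "\<forall>e>0. \<exists>N0. \<forall>N\<ge>N0. op_bound e (mcomm (Z N) a)"
      if a: "a \<in> calA x1" "\<And>i j. a i j \<noteq> 0 \<Longrightarrow> int i - int j = s"
        and g: "\<And>N i j. cmod ((\<gamma> N i - \<gamma> N j) * a i j) \<le> r N" for a s
    proof (intro allI impI)
      fix e :: real assume e: "e > 0"
      then have e2: "e/2 > 0" by simp
      obtain A where A: "banded A a" using band[OF a(1)] ..
      obtain N1 where N1: "\<And>N. N \<ge> N1 \<Longrightarrow>
          op_bound (e/2) (\<lambda>i j. of_real (1 - fejer (Suc N) (int i - int j - s)) * d a i j)"
        using fejer_converges[OF compact_group dA[OF a(1)] e2] by blast
      have "\<forall>\<^sub>F j in sequentially. r j < e/2"
        using r0 e2 by (intro order_tendstoD) auto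
      then obtain N2 where N2: "\<And>N. N \<ge> N2 \<Longrightarrow> r N < e/2" by (auto simp: eventually_sequentially)
      have "op_bound e (mcomm (Z N) a)" if "N \<ge> max N1 N2" for N
      proof -
        \<comment> \<open>Here \<open>X\<close> disappears: the commutator is the Fejer remainder of
          \<open>d a\<close>, which lies in \<open>algA\<close>, so \<open>fejer_converges\<close>
          applies.\<close>
        have "mcomm (P N) a = (\<lambda>i j. of_real (1 - fejer (Suc N) (int i - int j - s)) * d a i j)"
          unfolding dX[OF a(1)]
          by (intro ext mcomm_multiplier[where \<psi> = "\<lambda>n. of_real (1 - fejer (Suc N) n)"] a(2)) (simp_all add: P_def)
        then have 1: "op_bound (e/2) (mcomm (P N) a)" using N1[of N] that by simp
        have 2: "op_bound (e/2) (mcomm (mdiag (\<gamma> N)) a)"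
        proof (rule op_bound_homogeneous[of _ s])
          show "int i - int j = s" if "mcomm (mdiag (\<gamma> N)) a i j \<noteq> 0" for i j
            using that a(2)[of i j] by (auto simp: mcomm_mdiag)
          show "cmod (mcomm (mdiag (\<gamma> N)) a i j) \<le> e/2" for i j
            using g[of N i j] N2[of N] that by (simp add: mcomm_mdiag)
        qed
        show ?thesis
          unfolding Z mcomm_add_left[OF A] using op_bound_add[OF 1 2] by simp
      qed
      then show "\<exists>N0. \<forall>N\<ge>N0. op_bound e (mcomm (Z N) a)" by blast
    qed
    \<comment> \<open>Only the increments of \<open>\<gamma> N\<close> are controlled; commutators
      with the two shifts see nothing else, and those with diagonal matrices see nothing of
      \<open>\<gamma> N\<close> at all.\<close>
    have \<gamma>b: "cmod (\<gamma> N (Suc k) - \<gamma> N k) \<le> r N" for N k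
    proof -
      have "\<gamma> N (Suc k) - \<gamma> N k = \<alpha> k - c - (\<beta> N (Suc k) - \<beta> N k)"
        by (simp add: \<gamma>_def \<alpha>X algebra_simps)
      with \<beta>(2)[of k N] show ?thesis by simp
    qed
    have rp: "0 \<le> r N" for N by (simp add: r_def)
    have cU: "\<forall>e>0. \<exists>N0. \<forall>N\<ge>N0. op_bound e (mcomm (Z N) shiftU)"
      by (rule conv[OF calA.gen_U, of 1]) (use \<gamma>b rp in \<open>auto simp: shiftU_def split: if_splits\<close>)
    have cUs: "\<forall>e>0. \<exists>N0. \<forall>N\<ge>N0. op_bound e (mcomm (Z N) (madj shiftU))"
      by (rule conv[OF calA.gen_Ustar, of "-1"])
        (use \<gamma>b rp in \<open>auto simp: shiftU_def madj_def norm_minus_commute split: if_splits\<close>)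
    have cch: "\<forall>e>0. \<exists>N0. \<forall>N\<ge>N0. op_bound e (mcomm (Z N) (Mdiag x1 ch))" if "character ch" for ch
      by (rule conv[OF calA.gen_chi[OF that], of 0]) (use rp in \<open>auto simp: Mdiag_def split: if_splits\<close>)
    fix a assume a: "a \<in> calA x1"
    obtain A where A: "banded A a" using band[OF a] ..
    have eq: "msub (dt a) (mcomm (x N) a) = mcomm (Z N) a" for N
      unfolding Z_def mcomm_msub_left[OF A] dtY[OF a] ..
    have ca: "\<forall>e>0. \<exists>N0. \<forall>N\<ge>N0. op_bound e (mcomm (Z N) a)"
      by (rule mcomm_convergence_calA[OF compact_group cU cUs cch a])
    show "(\<lambda>N. opnorm (msub (dt a) (mcomm (x N) a))) \<longlonglongrightarrow> 0"
      unfolding eq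
    proof (rule LIMSEQ_I)
      fix e :: real assume "e > 0"
      then have "e/2 > 0" by simp
      then obtain N0 where N0: "\<And>N. N \<ge> N0 \<Longrightarrow> op_bound (e/2) (mcomm (Z N) a)"
        using ca by blast
      have "norm (opnorm (mcomm (Z N) a) - 0) < e" if "N \<ge> N0" for N
        using op_bound_imp_opnorm_le[OF N0[OF that]] \<open>e > 0\<close>
          op_bound_nonneg[OF bounded_op_imp_op_bound] by fastforce
      then show "\<exists>N0. \<forall>N\<ge>N0. norm (opnorm (mcomm (Z N) a) - 0) < e" by blast
    qed
  qed
  ultimately show ?thesis by blast
qed

end

theorem theorem3p8:
  fixes x1 :: "'g::{topological_ab_group_add, t2_space}"
    and d :: "mat \<Rightarrow> mat"
  assumes "compact (UNIV :: 'g set)"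
    and "infinite (UNIV :: 'g set)"
    and "closure (range (\<lambda>n::int. zmul n x1)) = UNIV"
    and "is_derivation x1 d"
  shows "\<exists>c0::complex. \<exists>dt :: mat \<Rightarrow> mat.
           is_derivation x1 dt \<and> approx_inner x1 dt \<and>
           (\<forall>a\<in>calA x1. d a = madd (msmult c0 (Kcomm a)) (dt a))"
proof -
  interpret monothetic x1
    using assms by unfold_locales
  show ?thesis
    by (rule derivation_decomposition[OF assms(2,4)])
qed

end
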